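(* Let $u\in\mathcal{L}(\mathbb{C}^n)$ and $x\in\mathbb{C}^n$. Then $$u(z)\le\Psi_{u,x}(z-x)+C\quad\text{for all } z\in\mathbb{C}^n$$ with $C=g'(u,x,0)$. Moreover, $\Psi_{u,x}$ is the least indicator satisfying such an inequality with some constant: if $\Phi\in\mathcal{I}$ and there is a constant $C'$ with $u(z)\le\Phi(z-x)+C'$ for all $z\in\mathbb{C}^n$, then $\Psi_{u,x}\le\Phi$ on $\mathbb{C}^n$.
   Context: Plurisubharmonic functions are, as usual, not identically $-\infty$. $\mathcal{L}=\mathcal{L}(\mathbb{C}^n)$ is the class of plurisubharmonic functions $u$ on $\mathbb{C}^n$ with $u(z)\le C_1\log^+|z|+C_2$ for all $z$, for some constants $C_1,C_2\ge0$ depending on $u$. An indicator is a function $\Phi\in\mathcal{L}$ that is $n$-circled, $\Phi(z)=\Phi(|z_1|,\dots,|z_n|)$, and whose convex image $\varphi(t)=\Phi(e^{t_1},\dots,e^{t_n})$, $t\in\mathbb{R}^n$, satisfies $\varphi(ct)=c\,\varphi(t)$ for all $c>0$, $t\in\mathbb{R}^n$; $\mathcal{I}$ is the set of all indicators. For $u\in\mathcal{L}$, $x\in\mathbb{C}^n$, $t\in\mathbb{R}^n$, let $g'(u,x,t)$ be the maximum of $u$ on $\{z:|z_k-x_k|=e^{t_k},\ 1\le k\le n\}$, and $\psi_{u,x}(t)=\lim_{R\to+\infty}R^{-1}g'(u,x,Rt)$ (the limit exists and is finite). The indicator of $u$ at $x$ is the function $\Psi_{u,x}\in\mathcal{I}$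 given by $\Psi_{u,x}(y)=\psi_{u,x}(\log|y_1|,\dots,\log|y_n|)$ for $y_1\cdots y_n\neq0$, extended (uniquely) to a plurisubharmonic function on $\mathbb{C}^n$. *)

theory Defs
  imports "HOL-Analysis.Analysis"
begin

text \<open>
  Plurisubharmonic functions take values in \<open>[-\<infinity>, \<infinity>)\<close>; they are rendered as \<^typ>\<open>ereal\<close>-valued
  functions that never take the value \<open>\<infinity>\<close>. The space \<open>\<complex>\<^sup>n\<close> is \<open>complex ^ 'n\<close> with its Euclidean norm.
\<close>

definition upper_semicontinuous :: "('a::topological_space \<Rightarrow> ereal) \<Rightarrow> bool" where
  "upper_semicontinuous u \<longleftrightarrow> (\<forall>c. open {z. u z < c})"

text \<open>
  The mean of \<open>v\<close> over the unit circle as a Lebesgue integral (positive minus negative part;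
  \<^const>\<open>e2ennreal\<close> sends negative numbers to 0). For an upper semicontinuous \<open>v\<close> without the
  value \<open>\<infinity>\<close> the positive part has a finite integral, so the difference is never \<open>\<infinity> - \<infinity>\<close>.
\<close>

definition circle_mean :: "(complex \<Rightarrow> ereal) \<Rightarrow> ereal" where
  "circle_mean v =
     (enn2ereal (\<integral>\<^sup>+\<theta>\<in>{0..2*pi}. e2ennreal (v (cis \<theta>)) \<partial>lborel)
      - enn2ereal (\<integral>\<^sup>+\<theta>\<in>{0..2*pi}. e2ennreal (- v (cis \<theta>)) \<partial>lborel)) / ereal (2 * pi)"

text \<open>
  As \<open>b\<close> ranges over all vectors, the circles \<open>{a + \<zeta> b : |\<zeta>| = 1}\<close> have every radius in every
  complex line, so the last clause is the sub-mean value property on complex lines.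
\<close>

definition psh :: "(complex ^ 'n::finite \<Rightarrow> ereal) \<Rightarrow> bool" where
  "psh u \<longleftrightarrow>
     upper_semicontinuous u \<and> (\<forall>z. u z \<noteq> \<infinity>) \<and> (\<exists>z. u z \<noteq> -\<infinity>) \<and>
     (\<forall>a b. u a \<le> circle_mean (\<lambda>\<zeta>. u (a + \<zeta> *s b)))"

text \<open>In the next definition, \<^term>\<open>ln (0::real) = 0\<close> gives the right value at the origin.\<close>

definition lelong_class :: "(complex ^ 'n::finite \<Rightarrow> ereal) set" where
  "lelong_class =
     {u. psh u \<and>
         (\<exists>C\<^sub>1 C\<^sub>2 :: real. C\<^sub>1 \<ge> 0 \<and> C\<^sub>2 \<ge> 0 \<and>
            (\<forall>z. u z \<le> ereal (C\<^sub>1 * max 0 (ln (norm z)) + C\<^sub>2)))}"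

definition circled :: "(complex ^ 'n::finite \<Rightarrow> ereal) \<Rightarrow> bool" where
  "circled \<Phi> \<longleftrightarrow> (\<forall>z. \<Phi> z = \<Phi> (\<chi> k. complex_of_real (cmod (z $ k))))"

definition convex_image :: "(complex ^ 'n::finite \<Rightarrow> ereal) \<Rightarrow> real ^ 'n \<Rightarrow> ereal" where
  "convex_image \<Phi> t = \<Phi> (\<chi> k. complex_of_real (exp (t $ k)))"

definition indicators :: "(complex ^ 'n::finite \<Rightarrow> ereal) set" where
  "indicators =
     {\<Phi>. \<Phi> \<in> lelong_class \<and> circled \<Phi> \<and>
         (\<forall>c>0. \<forall>t. convex_image \<Phi> (c *\<^sub>R t) = ereal c * convex_image \<Phi> t)}"

text \<open>The supremum is attained: \<open>u\<close> is upper semicontinuous and the torus is compact.\<close>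

definition torus_max :: "(complex ^ 'n::finite \<Rightarrow> ereal) \<Rightarrow> complex ^ 'n \<Rightarrow> real ^ 'n \<Rightarrow> ereal" where
  "torus_max u x t = (SUP z \<in> {z. \<forall>k. cmod (z $ k - x $ k) = exp (t $ k)}. u z)"

definition asymptotic_slope :: "(complex ^ 'n::finite \<Rightarrow> ereal) \<Rightarrow> complex ^ 'n \<Rightarrow> real ^ 'n \<Rightarrow> ereal" where
  "asymptotic_slope u x t = Lim at_top (\<lambda>R::real. ereal (inverse R) * torus_max u x (R *\<^sub>R t))"

text \<open>
  A plurisubharmonic function is determined by its values off the coordinate hyperplanes, so the
  description below picks out the unique plurisubharmonic extension.
\<close>

definition indicator_at :: "(complex ^ 'n::finite \<Rightarrow> ereal) \<Rightarrow> complex ^ 'n \<Rightarrow> complex ^ 'n \<Rightarrow> ereal" where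
  "indicator_at u x =
     (THE \<Psi>. psh \<Psi> \<and>
        (\<forall>y. (\<forall>k. y $ k \<noteq> 0) \<longrightarrow> \<Psi> y = asymptotic_slope u x (\<chi> k. ln (cmod (y $ k)))))"

end

theory Submission
  imports Defs "HOL-Complex_Analysis.Cauchy_Integral_Formula"
begin

text \<open>
  Write \<open>g t\<close> for the maximum of \<open>u\<close> over the torus \<open>|z\<^sub>k - x\<^sub>k| = exp t\<^sub>k\<close>. Everything rests on
  the convexity of \<open>g\<close> (\<open>torus_max_convex_combination\<close>), a several-variable form of Hadamard's
  three circles theorem. The holomorphic curves lying over a segment are \<open>z\<^sub>k = x\<^sub>k + c\<^sub>k exp (\<zeta>
  v\<^sub>k)\<close>, whereas the sub-mean value property is given on complex lines only; so convexity is
  proved by a touching argument. If it fails, then a penalised maximum places a quadratic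
  function of \<open>t\<close>, strictly concave in one direction \<open>w\<close>, above \<open>u\<close> with contact at a point
  \<open>z\<^sub>0\<close>. The small linear disc through \<open>z\<^sub>0\<close> with velocity \<open>w\<close> in logarithmic coordinates agrees
  with the segment to first order, and its mean of \<open>log |z\<^sub>k - x\<^sub>k|\<close> is the value at the centre;
  hence linear terms do not contribute, the concave term does, and the mean of \<open>u\<close> falls below
  \<open>u z\<^sub>0\<close> (\<open>psh_not_touched_by_concave_quadratic\<close>).

  Convexity makes the slope \<open>(g (R t) - g 0) / R\<close> increase with \<open>R\<close>, and logarithmic growth of
  \<open>u\<close> bounds it. Its limit \<open>\<psi> t\<close> therefore exists, \<open>g t \<le> g 0 + \<psi> t\<close> with no error term, and \<open>\<psi>\<close>
  is sublinear. Being at most \<open>C max (0, t\<^sub>1, \<dots>, t\<^sub>n)\<close>, a sublinear \<open>\<psi>\<close> is also monotone, so \<open>\<psi>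
  (log |y\<^sub>1|, \<dots>, log |y\<^sub>n|)\<close> extends over the coordinate hyperplanes as an infimum. The
  extension is plurisubharmonic because \<open>\<psi>\<close> is a supremum of linear functions with nonnegative
  coefficients \<open>m\<close>, and each \<open>\<Sum> m\<^sub>k log |y\<^sub>k|\<close> satisfies the sub-mean value inequality.

  Statements are proved off the hyperplanes and carried across them by
  \<open>psh_le_usc_off_hyperplanes\<close>: generic small circles avoid hyperplanes. This gives the
  uniqueness of the extension, the inequality for \<open>u\<close>, and minimality, where \<open>g (R t) \<le> R \<phi> t +
  C'\<close> is divided by \<open>R\<close>.
\<close>

section \<open>Circle means of upper semicontinuous functions\<close>

text \<open>
  The mean as a function of the angle: comparison functions below are given in terms of \<open>\<theta>\<close>, and
  a function on \<open>[0, 2\<pi>]\<close> need not come from one on the circle.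
\<close>

definition angular_mean :: "(real \<Rightarrow> ereal) \<Rightarrow> ereal" where
  "angular_mean f =
     (enn2ereal (\<integral>\<^sup>+\<theta>\<in>{0..2*pi}. e2ennreal (f \<theta>) \<partial>lborel)
      - enn2ereal (\<integral>\<^sup>+\<theta>\<in>{0..2*pi}. e2ennreal (- f \<theta>) \<partial>lborel)) / ereal (2 * pi)"

lemma circle_mean_eq_angular_mean: "circle_mean v = angular_mean (\<lambda>\<theta>. v (cis \<theta>))"
  by (simp add: circle_mean_def angular_mean_def)

lemma angular_mean_mono:
  assumes "\<And>\<theta>. \<theta> \<in> {0..2*pi} \<Longrightarrow> v \<theta> \<le> w \<theta>"
  shows "angular_mean v \<le> angular_mean w"
proof -
  have "(\<integral>\<^sup>+\<theta>\<in>{0..2*pi}. e2ennreal (v \<theta>) \<partial>lborel) \<le> (\<integral>\<^sup>+\<theta>\<in>{0..2*pi}. e2ennreal (w \<theta>) \<partial>lborel)"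
    "(\<integral>\<^sup>+\<theta>\<in>{0..2*pi}. e2ennreal (- w \<theta>) \<partial>lborel) \<le> (\<integral>\<^sup>+\<theta>\<in>{0..2*pi}. e2ennreal (- v \<theta>) \<partial>lborel)"
    by (intro nn_integral_mono; auto split: split_indicator intro!: e2ennreal_mono simp: assms)+
  then show ?thesis
    unfolding angular_mean_def
    by (intro ereal_divide_right_mono ereal_minus_mono) (auto simp: less_eq_ennreal.rep_eq)
qed

lemma angular_mean_continuous:
  fixes h :: "real \<Rightarrow> real"
  assumes h: "continuous_on {0..2*pi} h" and v: "\<And>\<theta>. \<theta> \<in> {0..2*pi} \<Longrightarrow> v \<theta> = ereal (h \<theta>)"
  shows "angular_mean v = ereal (integral {0..2*pi} h / (2*pi))"
proof -
  let ?I = "{0..2*pi}"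
  have *: "(\<integral>\<^sup>+\<theta>\<in>?I. ennreal (k \<theta>) \<partial>lborel) = ennreal (integral ?I (\<lambda>\<theta>. max 0 (k \<theta>)))"
    if k: "continuous_on ?I k" for k :: "real \<Rightarrow> real"
  proof -
    have c: "continuous_on ?I (\<lambda>\<theta>. max 0 (k \<theta>))" by (intro continuous_intros k)
    have "(\<integral>\<^sup>+\<theta>\<in>?I. ennreal (k \<theta>) \<partial>lborel) = (\<integral>\<^sup>+\<theta>. ennreal (indicator ?I \<theta> * max 0 (k \<theta>)) \<partial>lborel)"
      by (intro nn_integral_cong) (auto split: split_indicator simp: ennreal_neg max_def)
    also have "\<dots> = ennreal (LINT \<theta>|lborel. indicator ?I \<theta> * max 0 (k \<theta>))"
      using borel_integrable_atLeastAtMost'[OF c]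
      by (intro nn_integral_eq_integral) (auto simp: set_integrable_def)
    also have "(LINT \<theta>|lborel. indicator ?I \<theta> * max 0 (k \<theta>)) = integral ?I (\<lambda>\<theta>. max 0 (k \<theta>))"
      using set_borel_integral_eq_integral(2)[OF borel_integrable_atLeastAtMost'[OF c]]
      by (simp add: set_lebesgue_integral_def)
    finally show ?thesis .
  qed
  have P: "(\<integral>\<^sup>+\<theta>\<in>?I. e2ennreal (v \<theta>) \<partial>lborel) = ennreal (integral ?I (\<lambda>\<theta>. max 0 (h \<theta>)))"
    unfolding *[OF h, symmetric] by (intro nn_integral_cong) (auto split: split_indicator simp: v)
  have N: "(\<integral>\<^sup>+\<theta>\<in>?I. e2ennreal (- v \<theta>) \<partial>lborel) = ennreal (integral ?I (\<lambda>\<theta>. max 0 (- h \<theta>)))"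
    unfolding *[OF continuous_on_minus[OF h], symmetric]
    by (intro nn_integral_cong) (auto split: split_indicator simp: v)
  have i: "(\<lambda>\<theta>. max 0 (h \<theta>)) integrable_on ?I" "(\<lambda>\<theta>. max 0 (- h \<theta>)) integrable_on ?I"
    by (auto intro!: integrable_continuous_interval continuous_intros h)
  have "integral ?I (\<lambda>\<theta>. max 0 (h \<theta>)) - integral ?I (\<lambda>\<theta>. max 0 (- h \<theta>))
      = integral ?I (\<lambda>\<theta>. max 0 (h \<theta>) - max 0 (- h \<theta>))"
    by (rule integral_diff[symmetric]) (fact i)+
  also have "\<dots> = integral ?I h"
    by (intro integral_cong) auto
  finally have d: "integral ?I (\<lambda>\<theta>. max 0 (h \<theta>)) - integral ?I (\<lambda>\<theta>. max 0 (- h \<theta>)) = integral ?I h" .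
  have "0 \<le> integral ?I (\<lambda>\<theta>. max 0 (h \<theta>))" "0 \<le> integral ?I (\<lambda>\<theta>. max 0 (- h \<theta>))"
    by (auto intro!: integral_nonneg i)
  then show ?thesis
    unfolding angular_mean_def P N by (simp add: enn2ereal_ennreal d)
qed

lemma circle_mean_le:
  fixes h :: "real \<Rightarrow> real"
  assumes "(h has_integral H) {0..2*pi}" "continuous_on {0..2*pi} h"
    and "\<And>\<theta>. \<theta> \<in> {0..2*pi} \<Longrightarrow> v (cis \<theta>) \<le> ereal (h \<theta>)"
  shows "circle_mean v \<le> ereal (H / (2*pi))"
proof -
  have "circle_mean v \<le> angular_mean (\<lambda>\<theta>. ereal (h \<theta>))"
    unfolding circle_mean_eq_angular_mean by (intro angular_mean_mono assms)
  also have "\<dots> = ereal (H / (2*pi))"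
    using integral_unique[OF assms(1)] angular_mean_continuous[OF assms(2)] by simp
  finally show ?thesis .
qed

lemma circle_mean_ge:
  fixes h :: "real \<Rightarrow> real"
  assumes "(h has_integral H) {0..2*pi}" "continuous_on {0..2*pi} h"
    and "\<And>\<theta>. \<theta> \<in> {0..2*pi} \<Longrightarrow> ereal (h \<theta>) \<le> v (cis \<theta>)"
  shows "ereal (H / (2*pi)) \<le> circle_mean v"
proof -
  have "ereal (H / (2*pi)) = angular_mean (\<lambda>\<theta>. ereal (h \<theta>))"
    using integral_unique[OF assms(1)] angular_mean_continuous[OF assms(2)] by simp
  also have "\<dots> \<le> circle_mean v"
    unfolding circle_mean_eq_angular_mean by (intro angular_mean_mono assms)
  finally show ?thesis .
qed

lemma circle_mean_le_const:
  assumes "\<And>\<theta>. v (cis \<theta>) \<le> ereal c"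
  shows "circle_mean v \<le> ereal c"
proof -
  have "((\<lambda>_. c) has_integral (2*pi*c)) {0..2*pi}"
    using has_integral_const_real[of c 0 "2*pi"] by simp
  from circle_mean_le[OF this, of v] show ?thesis using assms by simp
qed

lemma usc_limsup:
  fixes V :: "'a::metric_space \<Rightarrow> ereal"
  assumes "upper_semicontinuous V" "X \<longlonglongrightarrow> a"
  shows "limsup (\<lambda>j. V (X j)) \<le> V a"
proof (rule dense_ge)
  fix c assume "V a < c"
  then have "eventually (\<lambda>j. X j \<in> {z. V z < c}) sequentially"
    using assms by (intro topological_tendstoD) (auto simp: upper_semicontinuous_def)
  then show "limsup (\<lambda>j. V (X j)) \<le> c"
    by (intro Limsup_bounded) (auto elim!: eventually_mono)
qed

lemma usc_borel_measurable:
  fixes V :: "'a::t2_space \<Rightarrow> ereal" and f :: "real \<Rightarrow> 'a"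
  assumes "upper_semicontinuous V" "continuous_on UNIV f"
  shows "(\<lambda>\<theta>. V (f \<theta>)) \<in> borel_measurable lborel"
proof (rule borel_measurableI_less)
  fix c
  have "open (f -` {z. V z < c})"
    using assms by (intro open_vimage) (auto simp: upper_semicontinuous_def)
  then show "{\<theta> \<in> space lborel. V (f \<theta>) < c} \<in> sets lborel"
    by (simp add: vimage_def)
qed

text \<open>
  Fatou's lemma for the negative parts, and its reverse for the uniformly bounded positive
  parts. It carries the sub-mean value inequality from generic circles to those that meet
  hyperplanes, where logarithms have singularities.
\<close>

lemma circle_mean_usc_limit:
  fixes V :: "complex ^ 'n::finite \<Rightarrow> ereal"
  assumes V: "upper_semicontinuous V"
    and a: "A \<longlonglongrightarrow> a" and b: "B \<longlonglongrightarrow> b"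
    and le: "\<And>j. L \<le> circle_mean (\<lambda>\<zeta>. V (A j + \<zeta> *s B j))"
    and M: "\<And>j \<theta>. V (A j + cis \<theta> *s B j) \<le> ereal M" "\<And>\<theta>. V (a + cis \<theta> *s b) \<le> ereal M"
    and L: "L \<noteq> \<infinity>"
  shows "L \<le> circle_mean (\<lambda>\<zeta>. V (a + \<zeta> *s b))"
proof (cases L)
  case (real l)
  let ?I = "{0..2*pi}"
  define P where "P = (\<lambda>j. \<integral>\<^sup>+\<theta>\<in>?I. e2ennreal (V (A j + cis \<theta> *s B j)) \<partial>lborel)"
  define N where "N = (\<lambda>j. \<integral>\<^sup>+\<theta>\<in>?I. e2ennreal (- V (A j + cis \<theta> *s B j)) \<partial>lborel)"
  define p where "p = (\<integral>\<^sup>+\<theta>\<in>?I. e2ennreal (V (a + cis \<theta> *s b)) \<partial>lborel)"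
  define n where "n = (\<integral>\<^sup>+\<theta>\<in>?I. e2ennreal (- V (a + cis \<theta> *s b)) \<partial>lborel)"
  have cont: "continuous_on UNIV (\<lambda>\<theta>. x + cis \<theta> *s y)" for x y :: "complex ^ 'n"
    unfolding vector_scalar_mult_def by (intro continuous_intros)
  have meas[measurable]: "(\<lambda>\<theta>. V (x + cis \<theta> *s y)) \<in> borel_measurable lborel" for x y
    by (rule usc_borel_measurable[OF V cont])
  have conv: "(\<lambda>j. A j + cis \<theta> *s B j) \<longlonglongrightarrow> a + cis \<theta> *s b" for \<theta>
    unfolding vector_scalar_mult_def by (intro tendsto_intros a b)
  have ls: "limsup (\<lambda>j. V (A j + cis \<theta> *s B j)) \<le> V (a + cis \<theta> *s b)" for \<theta>
    by (rule usc_limsup[OF V conv])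
  have PM: "P j \<le> ennreal M * ennreal (2*pi)" for j
  proof -
    have "P j \<le> (\<integral>\<^sup>+\<theta>\<in>?I. ennreal M \<partial>lborel)"
      unfolding P_def using M e2ennreal_mono[OF M(1)]
      by (intro nn_integral_mono) (auto split: split_indicator)
    then show ?thesis by (simp add: nn_integral_cmult_indicator)
  qed
  have p: "limsup P \<le> p"
  proof -
    have "limsup P \<le> (\<integral>\<^sup>+\<theta>. limsup (\<lambda>j. e2ennreal (V (A j + cis \<theta> *s B j)) * indicator ?I \<theta>) \<partial>lborel)"
      unfolding P_def
    proof (rule nn_integral_limsup[where w = "\<lambda>\<theta>. ennreal M * indicator ?I \<theta>"])
      show "AE \<theta> in lborel. e2ennreal (V (A j + cis \<theta> *s B j)) * indicator ?I \<theta> \<le> ennreal M * indicator ?I \<theta>" for j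
        using e2ennreal_mono[OF M(1), of j] by (auto split: split_indicator)
      show "(\<integral>\<^sup>+\<theta>. ennreal M * indicator ?I \<theta> \<partial>lborel) < \<infinity>"
        by (simp add: nn_integral_cmult_indicator ennreal_mult_less_top)
    qed measurable
    also have "\<dots> \<le> p"
      unfolding p_def
    proof (intro nn_integral_mono)
      fix \<theta> :: real
      have "limsup (\<lambda>j. e2ennreal (V (A j + cis \<theta> *s B j))) = e2ennreal (limsup (\<lambda>j. V (A j + cis \<theta> *s B j)))"
        by (intro Limsup_compose_continuous_mono continuous_on_e2ennreal) (auto simp: mono_def e2ennreal_mono)
      also have "\<dots> \<le> e2ennreal (V (a + cis \<theta> *s b))" by (rule e2ennreal_mono[OF ls])
      finally show "limsup (\<lambda>j. e2ennreal (V (A j + cis \<theta> *s B j)) * indicator ?I \<theta>)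
          \<le> e2ennreal (V (a + cis \<theta> *s b)) * indicator ?I \<theta>"
        by (auto split: split_indicator simp: Limsup_const)
    qed
    finally show ?thesis .
  qed
  have n: "n \<le> liminf N"
  proof -
    have "n \<le> (\<integral>\<^sup>+\<theta>. liminf (\<lambda>j. e2ennreal (- V (A j + cis \<theta> *s B j)) * indicator ?I \<theta>) \<partial>lborel)"
      unfolding n_def
    proof (intro nn_integral_mono)
      fix \<theta> :: real
      have "e2ennreal (- V (a + cis \<theta> *s b)) \<le> e2ennreal (- limsup (\<lambda>j. V (A j + cis \<theta> *s B j)))"
        using ls by (intro e2ennreal_mono) simp
      also have "\<dots> = e2ennreal (liminf (\<lambda>j. - V (A j + cis \<theta> *s B j)))"
        by (simp add: ereal_Liminf_uminus)
      also have "\<dots> = liminf (\<lambda>j. e2ennreal (- V (A j + cis \<theta> *s B j)))"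
        by (intro Liminf_compose_continuous_mono[symmetric] continuous_on_e2ennreal) (auto simp: mono_def e2ennreal_mono)
      finally show "e2ennreal (- V (a + cis \<theta> *s b)) * indicator ?I \<theta>
          \<le> liminf (\<lambda>j. e2ennreal (- V (A j + cis \<theta> *s B j)) * indicator ?I \<theta>)"
        by (auto split: split_indicator simp: Liminf_const)
    qed
    also have "\<dots> \<le> liminf N"
      unfolding N_def by (intro nn_integral_liminf) measurable
    finally show ?thesis .
  qed
  have pM: "p \<le> ennreal M * ennreal (2*pi)"
  proof -
    have "p \<le> (\<integral>\<^sup>+\<theta>\<in>?I. ennreal M \<partial>lborel)"
      unfolding p_def using e2ennreal_mono[OF M(2)]
      by (intro nn_integral_mono) (auto split: split_indicator)
    then show ?thesis by (simp add: nn_integral_cmult_indicator)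
  qed
  have fin: "q < top" if "q \<le> ennreal M * ennreal (2*pi)" for q
    using that by (rule order.strict_trans1) (simp add: ennreal_mult_less_top)
  \<comment> \<open>With a finite positive part the inequality can be rearranged, and then only sums remain.\<close>
  have iff: "ereal l \<le> (enn2ereal q - enn2ereal r) / ereal (2*pi) \<longleftrightarrow> ereal (2*pi*l) + enn2ereal r \<le> enn2ereal q"
    if q: "q < top" for q r
  proof -
    obtain q' where q': "q = ennreal q'" "q' \<ge> 0" using q by (cases q) auto
    show ?thesis
      by (cases r) (auto simp: q' enn2ereal_ennreal field_simps)
  qed
  have step: "ereal (2*pi*l) + enn2ereal (N j) \<le> enn2ereal (P j)" for j
  proof -
    have "ereal l \<le> (enn2ereal (P j) - enn2ereal (N j)) / ereal (2*pi)"
      using le[of j] by (simp add: circle_mean_def P_def N_def real)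
    then show ?thesis using iff[OF fin[OF PM]] by simp
  qed
  have "ereal (2*pi*l) + enn2ereal n \<le> ereal (2*pi*l) + enn2ereal (liminf N)"
    using n by (intro add_left_mono) (simp add: less_eq_ennreal.rep_eq)
  also have "enn2ereal (liminf N) = liminf (\<lambda>j. enn2ereal (N j))"
    by (intro Liminf_compose_continuous_mono[symmetric] continuous_on_enn2ereal) (auto simp: mono_def less_eq_ennreal.rep_eq)
  also have "ereal (2*pi*l) + \<dots> = liminf (\<lambda>j. ereal (2*pi*l) + enn2ereal (N j))"
    by (rule Liminf_add_ereal_left[symmetric]) auto
  also have "\<dots> \<le> liminf (\<lambda>j. enn2ereal (P j))"
    by (intro Liminf_mono always_eventually allI step)
  also have "\<dots> \<le> limsup (\<lambda>j. enn2ereal (P j))"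
    by (intro Liminf_le_Limsup) auto
  also have "\<dots> = enn2ereal (limsup P)"
    by (intro Limsup_compose_continuous_mono continuous_on_enn2ereal) (auto simp: mono_def less_eq_ennreal.rep_eq)
  also have "\<dots> \<le> enn2ereal p"
    using p by (simp add: less_eq_ennreal.rep_eq)
  finally show ?thesis
    using iff[OF fin[OF pM]] unfolding circle_mean_def p_def n_def real by simp
next
  case MInf then show ?thesis by simp
qed (use L in simp)

section \<open>Means of logarithms on circles\<close>

text \<open>
  The function \<open>ln |a + b \<zeta>|\<close> is the real part of a branch of the logarithm that is holomorphic
  on the closed unit disc; Cauchy's formula at the centre of the disc gives the mean.
\<close>

lemma has_integral_ln_cmod_circle:
  assumes "cmod b < cmod a"
  shows "((\<lambda>\<theta>. ln (cmod (a + cis \<theta> * b))) has_integral (2*pi * ln (cmod a))) {0..2*pi}"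
proof -
  define c where "c = b / a"
  have a: "a \<noteq> 0" using assms by auto
  then have c: "cmod c < 1" using assms by (simp add: c_def norm_divide)
  have re: "0 < Re (1 + \<zeta> * c)" if "cmod \<zeta> \<le> 1" for \<zeta>
  proof -
    have "cmod (\<zeta> * c) < 1"
      using mult_left_le_one_le[of "cmod c" "cmod \<zeta>"] that c by (simp add: norm_mult)
    then show ?thesis using complex_Re_le_cmod[of "- (\<zeta> * c)"] by simp
  qed
  have hol: "(\<lambda>\<zeta>. Ln (1 + \<zeta> * c)) holomorphic_on cball 0 1"
    using re by (intro holomorphic_intros) (force simp: complex_nonpos_Reals_iff)
  have "((\<lambda>\<zeta>. Ln (1 + \<zeta> * c) / (\<zeta> - 0)) has_contour_integral (2 * of_real pi * \<i> * Ln (1 + 0 * c))) (circlepath 0 1)"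
    using hol by (intro Cauchy_integral_circlepath_simple) auto
  then have "((\<lambda>\<theta>. Ln (1 + cis \<theta> * c) * \<i>) has_integral 0) {0..2*pi}"
    by (simp add: circlepath_def has_contour_integral_part_circlepath_iff mult.assoc)
  from has_integral_Im[OF this]
  have "((\<lambda>\<theta>. Im (Ln (1 + cis \<theta> * c) * \<i>)) has_integral 0) {0..2*pi}"
    by (simp only: zero_complex.sel)
  then have "((\<lambda>\<theta>. ln (cmod a) + Im (Ln (1 + cis \<theta> * c) * \<i>)) has_integral (2*pi * ln (cmod a) + 0)) {0..2*pi}"
    using has_integral_const_real[of "ln (cmod a)" 0 "2*pi"] by (intro has_integral_add) auto
  moreover have "ln (cmod a) + Im (Ln (1 + cis \<theta> * c) * \<i>) = ln (cmod (a + cis \<theta> * b))" for \<theta>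
  proof -
    have ne: "1 + cis \<theta> * c \<noteq> 0" using re[of "cis \<theta>"] by force
    have "a + cis \<theta> * b = a * (1 + cis \<theta> * c)" using a by (simp add: c_def field_simps)
    then show ?thesis using a ne by (simp add: norm_mult ln_mult)
  qed
  ultimately show ?thesis by simp
qed

text \<open>
  For \<open>|a| < |b|\<close> the roles of \<open>a\<close> and \<open>b\<close> can be exchanged since \<open>|a + b \<zeta>| = |cnj b + cnj a
  \<zeta>|\<close> on the unit circle, and the mean is then \<open>ln |b|\<close>.
\<close>

lemma ln_cmod_circle_submean:
  assumes "a \<noteq> 0" "cmod a \<noteq> cmod b"
  obtains H where "((\<lambda>\<theta>. ln (cmod (a + cis \<theta> * b))) has_integral H) {0..2*pi}" "2*pi * ln (cmod a) \<le> H"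
proof (cases "cmod b < cmod a")
  case True
  then show ?thesis using has_integral_ln_cmod_circle that by blast
next
  case False
  then have less: "cmod a < cmod b" using assms by simp
  have "cmod (a + cis \<theta> * b) = cmod (cnj b + cis \<theta> * cnj a)" for \<theta>
  proof -
    have "cmod (a + cis \<theta> * b) = cmod (cis (-\<theta>) * (a + cis \<theta> * b))"
      by (simp add: norm_mult)
    also have "\<dots> = cmod (cnj (cis (-\<theta>) * (a + cis \<theta> * b)))"
      by (simp only: complex_mod_cnj)
    also have "cnj (cis (-\<theta>) * (a + cis \<theta> * b)) = cnj b + cis \<theta> * cnj a"
      by (simp add: ring_distribs cis_cnj mult.assoc[symmetric] cis_mult)
    finally show ?thesis .
  qed
  then show ?thesis
    using has_integral_ln_cmod_circle[of "cnj a" "cnj b"] less assms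
    by (intro that[of "2*pi * ln (cmod b)"]) (auto simp: ln_mono)
qed

section \<open>Inequalities across hyperplanes\<close>

text \<open>
  Around any point, the circle in the direction \<open>(1, \<dots>, 1)\<close> meets the hyperplanes \<open>z\<^sub>k = x\<^sub>k\<close>
  for at most \<open>n\<close> radii. On every other small circle the hypothesis applies, and \<open>v\<close> is almost
  bounded by its value at the centre.
\<close>

lemma psh_le_usc_off_hyperplanes:
  fixes u v :: "complex ^ 'n::finite \<Rightarrow> ereal"
  assumes u: "psh u" and v: "upper_semicontinuous v"
    and le: "\<And>z. (\<And>k. z $ k \<noteq> x $ k) \<Longrightarrow> u z \<le> v z"
  shows "u z \<le> v z"
proof (rule dense_ge)
  fix c' assume "v z < c'"
  then obtain c :: real where c: "v z < ereal c" "ereal c < c'"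
    using ereal_dense2 by blast
  have "open {w. v w < ereal c}" "z \<in> {w. v w < ereal c}" using v c by (auto simp: upper_semicontinuous_def)
  then obtain \<delta> where \<delta>: "\<delta> > 0" "ball z \<delta> \<subseteq> {w. v w < ereal c}" by (meson openE)
  have "infinite ({0<..<\<delta> / real CARD('n)} - range (\<lambda>k. cmod (z $ k - x $ k)))"
    using \<delta> by (intro Diff_infinite_finite) auto
  then obtain r where "r \<in> {0<..<\<delta> / real CARD('n)} - range (\<lambda>k. cmod (z $ k - x $ k))"
    by (metis equals0I finite.emptyI)
  then have r: "0 < r" "r < \<delta> / real CARD('n)" "r \<notin> range (\<lambda>k. cmod (z $ k - x $ k))" by auto
  define b :: "complex ^ 'n" where "b = (\<chi> k. of_real r)"
  have "u z \<le> circle_mean (\<lambda>\<zeta>. u (z + \<zeta> *s b))" using u by (simp add: psh_def)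
  also have "\<dots> \<le> ereal c"
  proof (rule circle_mean_le_const)
    fix \<theta>
    have n: "cmod ((cis \<theta> *s b) $ k) = r" for k using r by (simp add: b_def norm_mult)
    have "norm (cis \<theta> *s b) \<le> (\<Sum>k\<in>UNIV. cmod ((cis \<theta> *s b) $ k))"
      unfolding norm_vec_def by (intro L2_set_le_sum) simp
    also have "\<dots> = real CARD('n) * r" unfolding n by simp
    also have "\<dots> < \<delta>" using r by (simp add: field_simps)
    finally have "z + cis \<theta> *s b \<in> ball z \<delta>" by (simp add: dist_norm)
    then have "v (z + cis \<theta> *s b) < ereal c" using \<delta> by auto
    moreover have "u (z + cis \<theta> *s b) \<le> v (z + cis \<theta> *s b)"
    proof (rule le)
      fix k
      show "(z + cis \<theta> *s b) $ k \<noteq> x $ k"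
      proof
        assume "(z + cis \<theta> *s b) $ k = x $ k"
        then have "z $ k - x $ k = - ((cis \<theta> *s b) $ k)" by (simp add: algebra_simps)
        then have "cmod (z $ k - x $ k) = r" using n[of k] by (metis norm_minus_cancel)
        then show False using r(3) by blast
      qed
    qed
    ultimately show "u (z + cis \<theta> *s b) \<le> ereal c" by simp
  qed
  finally show "u z \<le> c'" using c by simp
qed

section \<open>Maxima of upper semicontinuous functions\<close>

lemma usc_attains_max:
  assumes f: "upper_semicontinuous f" and S: "compact S" "S \<noteq> {}"
  obtains x where "x \<in> S" "\<And>y. y \<in> S \<Longrightarrow> f y \<le> f x"
proof (rule ccontr)
  assume "\<not> thesis"
  with that have *: "\<exists>y\<in>S. f x < f y" if "x \<in> S" for x using \<open>x \<in> S\<close> by (meson not_le)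
  have "S \<subseteq> (\<Union>y\<in>S. {x. f x < f y})"
  proof
    fix x assume "x \<in> S"
    from *[OF this] show "x \<in> (\<Union>y\<in>S. {x. f x < f y})" by blast
  qed
  moreover have "open {x. f x < f y}" for y using f by (simp add: upper_semicontinuous_def)
  ultimately obtain Y where Y: "Y \<subseteq> S" "finite Y" "S \<subseteq> (\<Union>y\<in>Y. {x. f x < f y})"
    using compactE_image[OF S(1), of S "\<lambda>y. {x. f x < f y}"] by metis
  have "Y \<noteq> {}" using Y S by auto
  then have "Max (f ` Y) \<in> f ` Y" using Y by (intro Max_in) auto
  then obtain y where y: "y \<in> Y" "f y = Max (f ` Y)" by auto
  have "y \<in> (\<Union>y\<in>Y. {x. f x < f y})" using y Y by blast
  then obtain y' where y': "y' \<in> Y" "f y < f y'" by blast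
  have "f y' \<le> Max (f ` Y)" using y' Y by (intro Max_ge) auto
  then show False using y y' by simp
qed

lemma usc_compose:
  assumes "upper_semicontinuous f" "continuous_on UNIV h"
  shows "upper_semicontinuous (\<lambda>t. f (h t))"
proof -
  have "{t. f (h t) < c} = h -` {z. f z < c}" for c by auto
  moreover have "open (h -` {z. f z < c})" for c
    using assms by (intro open_vimage) (auto simp: upper_semicontinuous_def)
  ultimately show ?thesis by (simp add: upper_semicontinuous_def)
qed

lemma usc_diff_continuous:
  fixes h :: "'a::topological_space \<Rightarrow> real"
  assumes f: "upper_semicontinuous f" and fin: "\<And>z. f z \<noteq> \<infinity>" and h: "continuous_on UNIV h"
  shows "upper_semicontinuous (\<lambda>z. f z - ereal (h z))"
  unfolding upper_semicontinuous_def
proof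
  fix c
  \<comment> \<open>Separating \<open>f\<close> from \<open>h\<close> by a real number \<open>r\<close> exhibits the sublevel set as a union of open
    sets.\<close>
  have sub: "f z - ereal (h z) < c \<longleftrightarrow> (\<exists>r. f z < ereal r \<and> ereal (r - h z) < c)" for z
  proof
    assume "f z - ereal (h z) < c"
    then obtain s where s: "f z - ereal (h z) < ereal s" "ereal s < c" using ereal_dense2 by blast
    then have "f z < ereal (s + h z)" by (cases "f z") auto
    then show "\<exists>r. f z < ereal r \<and> ereal (r - h z) < c" using s by (intro exI[of _ "s + h z"]) auto
  next
    assume "\<exists>r. f z < ereal r \<and> ereal (r - h z) < c"
    then obtain r where r: "f z < ereal r" "ereal (r - h z) < c" by blast
    then have "f z - ereal (h z) < ereal (r - h z)" by (cases "f z") auto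
    then show "f z - ereal (h z) < c" using r by simp
  qed
  have "open {z. ereal (r - h z) < c}" for r
  proof -
    have "continuous_on UNIV (\<lambda>z. ereal (r - h z))" by (intro continuous_intros h)
    then show ?thesis by (intro open_Collect_less continuous_on_const)
  qed
  moreover have "open {z. f z < ereal r}" for r using f by (simp add: upper_semicontinuous_def)
  moreover have "{z. f z - ereal (h z) < c} = (\<Union>r. {z. f z < ereal r} \<inter> {z. ereal (r - h z) < c})"
    unfolding sub by auto
  ultimately show "open {z. f z - ereal (h z) < c}" by (auto intro!: open_Int open_UN)
qed

section \<open>Convexity of the maximum over tori\<close>

definition log_coords :: "complex ^ 'n::finite \<Rightarrow> complex ^ 'n \<Rightarrow> real ^ 'n" where
  "log_coords x z = (\<chi> k. ln (cmod (z $ k - x $ k)))"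

lemma has_integral_cos_squared: "((\<lambda>\<theta>. (cos \<theta>)\<^sup>2) has_integral pi) {0..2*pi}"
proof -
  have "((\<lambda>\<theta>. (cos \<theta>)\<^sup>2) has_integral ((2*pi + sin (2*pi) * cos (2*pi)) / 2 - (0 + sin 0 * cos 0) / 2)) {0..2*pi}"
  proof (rule fundamental_theorem_of_calculus)
    fix t :: real
    have "((\<lambda>t. (t + sin t * cos t) / 2) has_real_derivative (1 + (cos t * cos t - sin t * sin t)) / 2) (at t within {0..2*pi})"
      by (auto intro!: derivative_eq_intros)
    moreover have "(1 + (cos t * cos t - sin t * sin t)) / 2 = (cos t)\<^sup>2"
      using sin_cos_squared_add[of t] by (simp add: power2_eq_square)
    ultimately show "((\<lambda>t. (t + sin t * cos t) / 2) has_vector_derivative (cos t)\<^sup>2) (at t within {0..2*pi})"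
      by (simp add: has_real_derivative_iff_has_vector_derivative)
  qed simp
  then show ?thesis by simp
qed

text \<open>
  The disc \<open>z\<^sub>0 + \<zeta> b\<close> with \<open>b\<^sub>k = r w\<^sub>k (z\<^sub>0 - x)\<^sub>k\<close> has logarithmic displacement \<open>s\<^sub>k = ln |1
  + r w\<^sub>k \<zeta>|\<close>, so \<open>s = r cos \<theta> w + O(r\<^sup>2)\<close> and every \<open>s\<^sub>k\<close> has mean 0. Hence \<open>m \<bullet> s\<close> has mean 0,
  \<open>(w \<bullet> s)\<^sup>2\<close> has mean \<open>r\<^sup>2 / 2 + O(r\<^sup>3)\<close>, and the part of \<open>s\<close> orthogonal to \<open>w\<close> contributes
  only \<open>O(r\<^sup>4)\<close>, whatever the size of \<open>K\<close>. For small \<open>r\<close> the mean of the upper bound is below \<open>u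
  z\<^sub>0\<close>.
\<close>

lemma psh_not_touched_by_concave_quadratic:
  fixes u :: "complex ^ 'n::finite \<Rightarrow> ereal" and m w :: "real ^ 'n"
  assumes u: "psh u" and w: "norm w = 1" and \<epsilon>: "\<epsilon> > 0" and K: "K \<ge> 0" and \<delta>: "\<delta> > 0"
    and z0: "\<And>k. z0 $ k \<noteq> x $ k" and fin: "u z0 \<noteq> -\<infinity>"
    and le: "\<And>z s. (\<And>k. z $ k \<noteq> x $ k) \<Longrightarrow> log_coords x z = log_coords x z0 + s \<Longrightarrow> norm s < \<delta> \<Longrightarrow>
      u z \<le> u z0 + ereal (m \<bullet> s - \<epsilon> * (w \<bullet> s)\<^sup>2 + K * ((norm s)\<^sup>2 - (w \<bullet> s)\<^sup>2))"
  shows False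
proof -
  obtain c where c: "u z0 = ereal c" using u fin by (cases "u z0") (auto simp: psh_def)
  \<comment> \<open>The three bounds keep the logarithms regular, the displacement below \<open>\<delta>\<close>, and the error
    terms below the concave gain.\<close>
  define r where "r = min (min (1/2) (\<delta>/4)) (\<epsilon> / (16 * (\<epsilon> + K)))"
  have r: "0 < r" "r \<le> 1/2" "2*r < \<delta>" "r \<le> \<epsilon> / (16 * (\<epsilon> + K))"
  proof -
    show "0 < r" using \<epsilon> K \<delta> by (simp add: r_def)
    have "r \<le> \<delta> / 4" by (simp only: r_def min_le_iff_disj order_refl simp_thms)
    then show "2*r < \<delta>" using \<delta> by simp
  qed (simp_all only: r_def min_le_iff_disj order_refl simp_thms)
  have small: "r\<^sup>2 * (- \<epsilon> / 2 + 4*\<epsilon>*r + 4*K*r\<^sup>2) < 0"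
  proof -
    have "r * (16 * (\<epsilon> + K)) \<le> \<epsilon>" using r(4) \<epsilon> K by (simp add: pos_le_divide_eq)
    moreover have "K * r\<^sup>2 \<le> K * r"
      using r K by (intro mult_left_mono) (simp_all add: power2_eq_square mult_left_le)
    ultimately have "- \<epsilon> / 2 + 4*\<epsilon>*r + 4*K*r\<^sup>2 < 0" using \<epsilon> by (simp add: algebra_simps)
    then show ?thesis using r by (simp add: mult_less_0_iff)
  qed
  define s where "s = (\<lambda>\<theta>. \<chi> k. ln (cmod (1 + cis \<theta> * of_real (r * w $ k))))"
  define b where "b = (\<chi> k. of_real (r * w $ k) * (z0 $ k - x $ k))"
  have wk: "\<bar>w $ k\<bar> \<le> 1" for k using component_le_norm_cart[of w k] w by simp
  have rw2: "r * \<bar>w $ k\<bar> \<le> 1/2" for k using mult_mono[OF r(2) wk[of k]] r by simp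
  have rw1: "cmod (cis \<theta> * of_real (r * w $ k)) \<le> r * \<bar>w $ k\<bar>" for \<theta> k
    using r by (simp add: norm_mult abs_mult)
  have ne: "1 + cis \<theta> * of_real (r * w $ k) \<noteq> 0" for \<theta> k
  proof
    assume "1 + cis \<theta> * of_real (r * w $ k) = 0"
    then have "cis \<theta> * of_real (r * w $ k) = - 1" by (simp add: add_eq_0_iff)
    then have "cmod (cis \<theta> * of_real (r * w $ k)) = 1" by simp
    then show False using rw1[of \<theta> k] rw2[of k] by linarith
  qed
  have e: "norm (s \<theta> - (r * cos \<theta>) *\<^sub>R w) \<le> 2 * r\<^sup>2" for \<theta>
  proof -
    have "norm (s \<theta> - (r * cos \<theta>) *\<^sub>R w) \<le> (\<Sum>k\<in>UNIV. \<bar>(s \<theta> - (r * cos \<theta>) *\<^sub>R w) $ k\<bar>)"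
      by (rule norm_le_l1_cart)
    also have "\<dots> \<le> (\<Sum>k\<in>UNIV. 2 * r\<^sup>2 * (w $ k)\<^sup>2)"
    proof (rule sum_mono)
      fix k
      define \<zeta> where "\<zeta> = cis \<theta> * of_real (r * w $ k)"
      have z: "cmod \<zeta> \<le> r * \<bar>w $ k\<bar>" "cmod \<zeta> \<le> 1/2" using rw1[of \<theta> k] rw2[of k] by (auto simp: \<zeta>_def)
      have "(s \<theta> - (r * cos \<theta>) *\<^sub>R w) $ k = Re (Ln (1 + \<zeta>) - \<zeta>)"
        using ne[of \<theta> k] by (simp add: s_def \<zeta>_def mult.commute mult.left_commute)
      also have "\<bar>\<dots>\<bar> \<le> cmod (Ln (1 + \<zeta>) - \<zeta>)" by (rule abs_Re_le_cmod)
      also have "\<dots> \<le> (cmod \<zeta>)\<^sup>2 / (1 - cmod \<zeta>)" using z by (intro Ln_approx_linear) auto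
      also have "\<dots> \<le> (cmod \<zeta>)\<^sup>2 / (1/2)" using z by (intro divide_left_mono) auto
      also have "\<dots> \<le> 2 * (r * \<bar>w $ k\<bar>)\<^sup>2" using z by (simp add: power_mono)
      finally show "\<bar>(s \<theta> - (r * cos \<theta>) *\<^sub>R w) $ k\<bar> \<le> 2 * r\<^sup>2 * (w $ k)\<^sup>2" by (simp add: power_mult_distrib)
    qed
    also have "\<dots> = 2 * r\<^sup>2 * (norm w)\<^sup>2"
      by (simp add: norm_vec_def L2_set_def sum_nonneg sum_distrib_left)
    finally show ?thesis using w by simp
  qed
  have ww: "w \<bullet> w = 1" using w by (simp add: norm_eq_1)
  define h where "h = (\<lambda>\<theta>. c + m \<bullet> s \<theta> + (- \<epsilon> * r\<^sup>2) * (cos \<theta>)\<^sup>2 + (4*\<epsilon>*r^3 + 4*K*r^4))"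
  have bound: "u (z0 + cis \<theta> *s b) \<le> ereal (h \<theta>)" for \<theta>
  proof -
    have zk: "(z0 + cis \<theta> *s b) $ k - x $ k = (z0 $ k - x $ k) * (1 + cis \<theta> * of_real (r * w $ k))" for k
      by (simp add: b_def algebra_simps)
    define a where "a = r * cos \<theta>"
    define d where "d = s \<theta> - a *\<^sub>R w"
    have d: "norm d \<le> 2 * r\<^sup>2" using e by (simp add: d_def a_def)
    have sd: "s \<theta> = a *\<^sub>R w + d" by (simp add: d_def)
    have wd: "\<bar>w \<bullet> d\<bar> \<le> 2 * r\<^sup>2" using Cauchy_Schwarz_ineq2[of w d] w d by simp
    have a: "\<bar>a\<bar> \<le> r" using r by (simp add: a_def abs_mult mult_left_le)
    have "norm (s \<theta>) \<le> \<bar>a\<bar> + 2*r\<^sup>2" using norm_triangle_ineq[of "a *\<^sub>R w" d] w d by (simp add: sd)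
    also have "\<dots> \<le> 2*r" using a mult_left_mono[OF r(2), of r] r(1) unfolding power2_eq_square by linarith
    finally have ns: "norm (s \<theta>) < \<delta>" using r by simp
    have ws: "w \<bullet> s \<theta> = a + w \<bullet> d" by (simp add: sd inner_add_right ww)
    have q1: "a\<^sup>2 - 4*r^3 \<le> (w \<bullet> s \<theta>)\<^sup>2"
    proof -
      have "\<bar>a * (w \<bullet> d)\<bar> \<le> r * (2*r\<^sup>2)" unfolding abs_mult using a wd r by (intro mult_mono) auto
      then have "- (2 * r^3) \<le> a * (w \<bullet> d)" by (simp add: power2_eq_square power3_eq_cube abs_le_iff)
      then show ?thesis unfolding ws power2_sum using zero_le_power2[of "w \<bullet> d"] by linarith
    qed
    have q2: "(norm (s \<theta>))\<^sup>2 - (w \<bullet> s \<theta>)\<^sup>2 \<le> 4*r^4"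
    proof -
      have "(norm (s \<theta>))\<^sup>2 = a\<^sup>2 + 2*a*(w \<bullet> d) + (norm d)\<^sup>2"
        unfolding sd power2_norm_eq_inner
        by (simp only: inner_add inner_scaleR_left inner_scaleR_right ww)
          (simp add: inner_commute power2_eq_square algebra_simps)
      then have "(norm (s \<theta>))\<^sup>2 - (w \<bullet> s \<theta>)\<^sup>2 \<le> (norm d)\<^sup>2" by (simp add: ws power2_sum)
      also have "\<dots> \<le> (2*r\<^sup>2)\<^sup>2" by (rule power_mono[OF d]) simp
      finally show ?thesis by (simp add: power_mult_distrib)
    qed
    have "u (z0 + cis \<theta> *s b) \<le> u z0 + ereal (m \<bullet> s \<theta> - \<epsilon> * (w \<bullet> s \<theta>)\<^sup>2 + K * ((norm (s \<theta>))\<^sup>2 - (w \<bullet> s \<theta>)\<^sup>2))"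
    proof (rule le[OF _ _ ns])
      show "(z0 + cis \<theta> *s b) $ k \<noteq> x $ k" for k using zk[of k] ne[of \<theta> k] z0[of k] by force
      show "log_coords x (z0 + cis \<theta> *s b) = log_coords x z0 + s \<theta>"
        using ne z0 unfolding log_coords_def s_def zk by (simp add: vec_eq_iff norm_mult ln_mult)
    qed
    also have "\<dots> \<le> ereal (h \<theta>)"
      using mult_left_mono[OF q1, of \<epsilon>] mult_left_mono[OF q2, of K] \<epsilon> K
      by (simp add: c h_def a_def algebra_simps power_mult_distrib)
    finally show ?thesis .
  qed
  have "((\<lambda>\<theta>. m \<bullet> s \<theta>) has_integral (\<Sum>k\<in>UNIV. m $ k * 0)) {0..2*pi}"
    unfolding inner_vec_def inner_real_def
  proof (intro has_integral_sum has_integral_mult_right)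
    fix k
    show "((\<lambda>\<theta>. s \<theta> $ k) has_integral 0) {0..2*pi}"
      using has_integral_ln_cmod_circle[of "of_real (r * w $ k)" 1] rw1[of 0 k] rw2[of k] by (simp add: s_def)
  qed auto
  then have "(h has_integral (2*pi*c + 0 + (- \<epsilon> * r\<^sup>2) * pi + 2*pi*(4*\<epsilon>*r^3 + 4*K*r^4))) {0..2*pi}"
    unfolding h_def
    using has_integral_const_real[of c 0 "2*pi"] has_integral_const_real[of "4*\<epsilon>*r^3 + 4*K*r^4" 0 "2*pi"]
    by (intro has_integral_add has_integral_mult_right has_integral_cos_squared) auto
  moreover have "continuous_on {0..2*pi} h"
    unfolding h_def s_def inner_vec_def using ne by (intro continuous_intros) (auto simp: continuous_on_cis)
  ultimately have "circle_mean (\<lambda>\<zeta>. u (z0 + \<zeta> *s b))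
      \<le> ereal ((2*pi*c + 0 + (- \<epsilon> * r\<^sup>2) * pi + 2*pi*(4*\<epsilon>*r^3 + 4*K*r^4)) / (2*pi))"
    using circle_mean_le[of h _ "\<lambda>\<zeta>. u (z0 + \<zeta> *s b)"] bound by blast
  also have "(2*pi*c + 0 + (- \<epsilon> * r\<^sup>2) * pi + 2*pi*(4*\<epsilon>*r^3 + 4*K*r^4)) / (2*pi)
      = c + r\<^sup>2 * (- \<epsilon> / 2 + 4*\<epsilon>*r + 4*K*r\<^sup>2)"
    by (simp add: field_simps eval_nat_numeral)
  also have "ereal \<dots> < ereal c" using small by simp
  finally have "circle_mean (\<lambda>\<zeta>. u (z0 + \<zeta> *s b)) < u z0" using c by simp
  then show False using u by (simp add: psh_def not_less[symmetric])
qed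

definition torus_point :: "complex ^ 'n::finite \<Rightarrow> real ^ 'n \<Rightarrow> real ^ 'n \<Rightarrow> complex ^ 'n" where
  "torus_point x \<theta> t = (\<chi> k. x $ k + of_real (exp (t $ k)) * cis (\<theta> $ k))"

lemma torus_point_surj:
  assumes "\<And>k. z $ k \<noteq> x $ k"
  obtains \<theta> where "\<theta> \<in> cbox 0 (\<chi> k. 2*pi)" "z = torus_point x \<theta> (log_coords x z)"
proof
  show "(\<chi> k. Arg2pi (z $ k - x $ k)) \<in> cbox 0 (\<chi> k. 2*pi)"
    by (auto simp: mem_box_cart Arg2pi_ge_0 Arg2pi_lt_2pi less_imp_le)
  show "z = torus_point x (\<chi> k. Arg2pi (z $ k - x $ k)) (log_coords x z)"
    using assms Arg2pi_eq by (simp add: vec_eq_iff torus_point_def log_coords_def cis_conv_exp)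
qed

lemma cmod_torus_point: "cmod (torus_point x \<theta> t $ k - x $ k) = exp (t $ k)"
  by (simp add: torus_point_def norm_mult)

lemma torus_point_off_hyperplanes: "torus_point x \<theta> t $ k \<noteq> x $ k"
  by (simp add: torus_point_def)

lemma log_coords_torus_point: "log_coords x (torus_point x \<theta> t) = t"
  by (simp add: log_coords_def cmod_torus_point)

lemma continuous_torus_point: "continuous_on UNIV (\<lambda>p. torus_point x (fst p) (snd p))"
  unfolding torus_point_def cis_conv_exp by (intro continuous_intros)

lemma le_torus_max: "(\<And>k. z $ k \<noteq> x $ k) \<Longrightarrow> u z \<le> torus_max u x (log_coords x z)"
  unfolding torus_max_def log_coords_def by (intro SUP_upper) simp

lemma torus_max_le:
  assumes "\<And>z. (\<And>k. z $ k \<noteq> x $ k) \<Longrightarrow> log_coords x z = t \<Longrightarrow> u z \<le> c"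
  shows "torus_max u x t \<le> c"
  unfolding torus_max_def
proof (rule SUP_least, clarify)
  fix z assume z: "\<forall>k. cmod (z $ k - x $ k) = exp (t $ k)"
  then have "z $ k \<noteq> x $ k" for k by (metis exp_not_eq_zero norm_zero right_minus_eq)
  moreover have "log_coords x z = t" using z by (simp add: log_coords_def)
  ultimately show "u z \<le> c" using assms by blast
qed

lemma torus_point_le_torus_max: "u (torus_point x \<theta> t) \<le> torus_max u x t"
  using le_torus_max[of "torus_point x \<theta> t" x u] by (simp add: torus_point_off_hyperplanes log_coords_torus_point)

text \<open>
  One radius \<open>\<rho>\<close> serves for all angles because they range over a compact set.
\<close>

lemma torus_max_usc_nhd:
  assumes u: "upper_semicontinuous u" and lt: "torus_max u x p < c"
  obtains \<rho> where "\<rho> > 0" "\<And>t \<theta>. dist p t < \<rho> \<Longrightarrow> \<theta> \<in> cbox 0 (\<chi> k. 2*pi) \<Longrightarrow> u (torus_point x \<theta> t) < c"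
proof -
  let ?T = "{q. c \<le> u (torus_point x (fst q) (snd q))}"
  let ?S = "{t. \<exists>\<theta>. \<theta> \<in> cbox 0 (\<chi> k. 2*pi) \<and> (\<theta>, t) \<in> ?T}"
  have "- ?T = (\<lambda>q. torus_point x (fst q) (snd q)) -` {z. u z < c}" by auto
  moreover have "open \<dots>"
    using u by (intro open_vimage continuous_torus_point) (simp add: upper_semicontinuous_def)
  ultimately have "closed ?T" by (simp add: closed_def)
  then have "closed ?S" by (intro closed_compact_projection compact_cbox)
  moreover have "\<not> c \<le> u (torus_point x \<theta> p)" for \<theta>
    using le_less_trans[OF torus_point_le_torus_max[of u x \<theta> p] lt] by (simp add: not_le)
  then have "p \<in> - ?S" by simp
  ultimately have "open (- ?S)" "p \<in> - ?S" by (simp_all only: open_Compl)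
  then obtain \<rho> where "\<rho> > 0" "ball p \<rho> \<subseteq> - ?S" by (rule openE)
  then show ?thesis by (intro that[of \<rho>]) (auto simp: subset_eq not_le)
qed

text \<open>
  Suppose \<open>u z\<^sub>1\<close> exceeds the affine interpolation \<open>lin\<close> at a point \<open>tm\<close> of the segment. Let \<open>\<tau>\<close>
  be the coordinate along the segment and \<open>N\<close> the squared distance from its line, and maximise
  \<open>u - Q\<close> with \<open>Q = lin - \<epsilon> \<tau>\<^sup>2 + K N\<close> over a thin tube around the segment. At the ends of the
  tube \<open>u\<close> is close to the prescribed bounds, and on its lateral boundary \<open>K N\<close> is large; both
  keep \<open>u - Q\<close> below its value at \<open>z\<^sub>1\<close>. So the maximum is interior, where \<open>Q\<close> touches \<open>u\<close> from
  above up to a constant, which is impossible. The formulation with real upper bounds \<open>\<alpha>\<close> and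
  \<open>\<beta>\<close> also covers the value \<open>-\<infinity>\<close>.
\<close>

lemma torus_max_convex_combination:
  fixes u :: "complex ^ 'n::finite \<Rightarrow> ereal" and p q :: "real ^ 'n"
  assumes u: "psh u" and p: "torus_max u x p \<le> ereal \<alpha>" and q: "torus_max u x q \<le> ereal \<beta>"
    and \<mu>: "0 \<le> \<mu>" "\<mu> \<le> 1"
  shows "torus_max u x ((1 - \<mu>) *\<^sub>R p + \<mu> *\<^sub>R q) \<le> ereal ((1 - \<mu>) * \<alpha> + \<mu> * \<beta>)"
proof (cases "p = q")
  case True
  have "(1 - \<mu>) * min \<alpha> \<beta> + \<mu> * min \<alpha> \<beta> \<le> (1 - \<mu>) * \<alpha> + \<mu> * \<beta>"
    using \<mu> by (intro add_mono mult_left_mono) auto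
  also have "(1 - \<mu>) * min \<alpha> \<beta> + \<mu> * min \<alpha> \<beta> = min \<alpha> \<beta>" by (simp add: algebra_simps)
  finally have "ereal (min \<alpha> \<beta>) \<le> ereal ((1 - \<mu>) * \<alpha> + \<mu> * \<beta>)" by (simp only: ereal_less_eq)
  moreover have "torus_max u x p \<le> ereal (min \<alpha> \<beta>)" using p q True by (simp add: min_def)
  moreover have "(1 - \<mu>) *\<^sub>R p + \<mu> *\<^sub>R q = p" using True by (simp add: algebra_simps)
  ultimately show ?thesis by (metis order_trans)
next
  case False
  define D where "D = norm (q - p)"
  define w where "w = (1 / D) *\<^sub>R (q - p)"
  have D: "D > 0" using False by (simp add: D_def)
  have w: "norm w = 1" using D by (simp add: w_def D_def)
  have ww: "w \<bullet> w = 1" using w by (simp add: norm_eq_1)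
  have qp: "q = p + D *\<^sub>R w" using D by (simp add: w_def)
  define tm where "tm = (1 - \<mu>) *\<^sub>R p + \<mu> *\<^sub>R q"
  have tm: "tm = p + (\<mu> * D) *\<^sub>R w" by (simp add: tm_def qp algebra_simps)
  let ?B = "cbox 0 (\<chi> k. 2*pi) :: (real ^ 'n) set"
  have usc: "upper_semicontinuous u" and ninf: "\<And>z. u z \<noteq> \<infinity>" using u by (auto simp: psh_def)
  show ?thesis
  proof (rule torus_max_le, rule ccontr)
    fix z1 assume z1: "\<And>k. z1 $ k \<noteq> x $ k" and lz1: "log_coords x z1 = (1 - \<mu>) *\<^sub>R p + \<mu> *\<^sub>R q"
      and "\<not> u z1 \<le> ereal ((1 - \<mu>) * \<alpha> + \<mu> * \<beta>)"
    then obtain c where c: "ereal ((1 - \<mu>) * \<alpha> + \<mu> * \<beta>) < ereal c" "ereal c < u z1"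
      using ereal_dense2 unfolding not_le by blast
    \<comment> \<open>One \<open>\<eta>\<close> pays for the semicontinuity at the ends, one for the term \<open>\<epsilon> \<tau>\<^sup>2 \<le> \<eta>\<close>; the
      third is the excess at \<open>z\<^sub>1\<close> that remains.\<close>
    define \<eta> where "\<eta> = (c - ((1 - \<mu>) * \<alpha> + \<mu> * \<beta>)) / 3"
    have \<eta>: "\<eta> > 0" using c by (simp add: \<eta>_def)
    define \<epsilon> where "\<epsilon> = \<eta> / D\<^sup>2"
    have \<epsilon>: "\<epsilon> > 0" "\<epsilon> * D\<^sup>2 = \<eta>" using \<eta> D by (auto simp: \<epsilon>_def)
    have "torus_max u x p < ereal (\<alpha> + \<eta>)" "torus_max u x q < ereal (\<beta> + \<eta>)"
      using p q \<eta> by (auto intro: order.strict_trans1)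
    note near = torus_max_usc_nhd[OF usc this(1)] torus_max_usc_nhd[OF usc this(2)]
    obtain \<rho>1 where \<rho>1: "\<rho>1 > 0"
        "\<And>t \<theta>. dist p t < \<rho>1 \<Longrightarrow> \<theta> \<in> ?B \<Longrightarrow> u (torus_point x \<theta> t) < ereal (\<alpha> + \<eta>)"
      using near(1) by blast
    obtain \<rho>2 where \<rho>2: "\<rho>2 > 0"
        "\<And>t \<theta>. dist q t < \<rho>2 \<Longrightarrow> \<theta> \<in> ?B \<Longrightarrow> u (torus_point x \<theta> t) < ereal (\<beta> + \<eta>)"
      using near(2) by blast
    define \<delta> where "\<delta> = min \<rho>1 \<rho>2 / 2"
    have \<delta>: "\<delta> > 0" "\<delta> < \<rho>1" "\<delta> < \<rho>2" using \<rho>1(1) \<rho>2(1) by (auto simp: \<delta>_def)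
    define \<tau> where "\<tau> = (\<lambda>t. w \<bullet> (t - p))"
    define N where "N = (\<lambda>t. (norm (t - p))\<^sup>2 - (w \<bullet> (t - p))\<^sup>2)"
    have N0: "N t \<ge> 0" for t
      using Cauchy_Schwarz_ineq2[of w "t - p"] w by (simp add: N_def abs_le_square_iff[symmetric])
    define Tube where "Tube = {t. 0 \<le> \<tau> t \<and> \<tau> t \<le> D \<and> N t \<le> \<delta>\<^sup>2}"
    have cont: "continuous_on UNIV \<tau>" "continuous_on UNIV N"
      unfolding \<tau>_def N_def by (intro continuous_intros)+
    have closed: "closed Tube"
      unfolding Tube_def by (intro closed_Collect_conj closed_Collect_le continuous_intros cont)
    have "norm (t - p) \<le> \<delta> + D" if "t \<in> Tube" for t
    proof (rule power2_le_imp_le)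
      have "(norm (t - p))\<^sup>2 = N t + (\<tau> t)\<^sup>2" by (simp add: N_def \<tau>_def)
      also have "\<dots> \<le> \<delta>\<^sup>2 + D\<^sup>2" using that by (intro add_mono power_mono) (auto simp: Tube_def)
      also have "\<dots> \<le> (\<delta> + D)\<^sup>2" using \<delta> D by (simp add: power2_sum)
      finally show "(norm (t - p))\<^sup>2 \<le> (\<delta> + D)\<^sup>2" .
    qed (use \<delta> D in simp)
    then have "Tube \<subseteq> cball p (\<delta> + D)" by (auto simp: dist_norm norm_minus_commute)
    then have "compact Tube" using closed by (meson bounded_cball bounded_subset compact_eq_bounded_closed)
    then have comp: "compact (?B \<times> Tube)" by (intro compact_Times compact_cbox)
    have tau_tm: "\<tau> tm = \<mu> * D" and N_tm: "N tm = 0" and tm_Tube: "tm \<in> Tube"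
    proof -
      show 1: "\<tau> tm = \<mu> * D" by (simp add: \<tau>_def tm ww)
      show 2: "N tm = 0" using w by (simp add: N_def tm ww)
      show "tm \<in> Tube" using 1 2 \<mu> D by (simp add: Tube_def mult_left_le_one_le)
    qed
    have ne: "?B \<times> Tube \<noteq> {}" 
    proof -
      have "(0::real ^ 'n) \<in> ?B" by (simp add: mem_box_cart)
      then show ?thesis using tm_Tube by blast
    qed
    let ?F = "\<lambda>a. torus_point x (fst a) (snd a)"
    have uscF: "upper_semicontinuous (\<lambda>a. u (?F a))" by (rule usc_compose[OF usc continuous_torus_point])
    obtain a1 where a1: "\<And>a. a \<in> ?B \<times> Tube \<Longrightarrow> u (?F a) \<le> u (?F a1)"
      using usc_attains_max[OF uscF comp ne] by blast
    obtain M where "u (?F a1) \<le> ereal M"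
      using ninf[of "?F a1"] by (cases "u (?F a1)") auto
    then have M: "u (?F a) \<le> ereal M" if "a \<in> ?B \<times> Tube" for a
      using a1[OF that] by (rule order_trans[rotated])
    \<comment> \<open>\<open>K\<close> makes \<open>Q \<ge> M\<close> on the lateral boundary, where \<open>N = \<delta>\<^sup>2\<close>.\<close>
    define K where "K = (\<bar>M\<bar> + \<bar>\<alpha>\<bar> + \<bar>\<beta>\<bar> + \<eta>) / \<delta>\<^sup>2"
    have K: "K \<ge> 0" "K * \<delta>\<^sup>2 = \<bar>M\<bar> + \<bar>\<alpha>\<bar> + \<bar>\<beta>\<bar> + \<eta>" using \<delta> \<eta> by (auto simp: K_def)
    define lin where "lin = (\<lambda>t. \<alpha> + (\<beta> - \<alpha>) / D * \<tau> t)"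
    define Q where "Q = (\<lambda>t. lin t - \<epsilon> * (\<tau> t)\<^sup>2 + K * N t)"
    have contQ: "continuous_on UNIV (\<lambda>a. Q (snd a))"
      unfolding Q_def lin_def \<tau>_def N_def by (intro continuous_intros)
    obtain a0 where a0: "a0 \<in> ?B \<times> Tube"
      and max: "\<And>a. a \<in> ?B \<times> Tube \<Longrightarrow> u (?F a) - ereal (Q (snd a)) \<le> u (?F a0) - ereal (Q (snd a0))"
      using usc_attains_max[OF usc_diff_continuous[OF uscF _ contQ] comp ne] ninf by auto
    obtain \<theta>0 t0 where a0_eq: "a0 = (\<theta>0, t0)" by (cases a0)
    have t0: "\<theta>0 \<in> ?B" "t0 \<in> Tube" using a0 by (auto simp: a0_eq)
    define z0 where "z0 = torus_point x \<theta>0 t0"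
    have big: "u z - ereal (Q (log_coords x z)) \<le> u z0 - ereal (Q t0)"
      if z: "\<And>k. z $ k \<noteq> x $ k" and "log_coords x z \<in> Tube" for z
    proof -
      obtain \<theta> where "\<theta> \<in> ?B" "z = torus_point x \<theta> (log_coords x z)"
        using torus_point_surj[of z x] z by blast
      then show ?thesis using max[of "(\<theta>, log_coords x z)"] that by (simp add: a0_eq z0_def)
    qed
    have "ereal (3 * \<eta>) < u z1 - ereal (Q tm)"
    proof -
      have "lin tm = (1 - \<mu>) * \<alpha> + \<mu> * \<beta>" using D by (simp add: lin_def tau_tm field_simps)
      then have "Q tm \<le> (1 - \<mu>) * \<alpha> + \<mu> * \<beta>" using \<epsilon> by (simp add: Q_def N_tm)
      then have "3 * \<eta> \<le> c - Q tm" by (simp add: \<eta>_def)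
      then show ?thesis using c(2) by (cases "u z1") auto
    qed
    also have "\<dots> \<le> u z0 - ereal (Q t0)" using big[OF z1] tm_Tube lz1 by (simp add: tm_def)
    finally have lower: "ereal (3 * \<eta>) < u z0 - ereal (Q t0)" .
    then obtain c0 where c0: "u z0 = ereal c0" using ninf[of z0] by (cases "u z0") auto
    have lower': "3 * \<eta> + Q t0 < c0" using lower c0 by simp
    have taus: "0 \<le> \<tau> t0" "\<tau> t0 \<le> D" "N t0 \<le> \<delta>\<^sup>2" using t0 by (auto simp: Tube_def)
    have ets: "\<epsilon> * (\<tau> t0)\<^sup>2 \<le> \<eta>"
      using mult_left_mono[OF power_mono[OF taus(2) taus(1), of 2], of \<epsilon>] \<epsilon> by simp
    have KN: "0 \<le> K * N t0" using K N0 by simp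
    have tau_pos: "0 < \<tau> t0"
    proof (rule ccontr)
      assume "\<not> 0 < \<tau> t0"
      then have 0: "\<tau> t0 = 0" using taus by simp
      then have "(norm (t0 - p))\<^sup>2 \<le> \<delta>\<^sup>2" using taus by (simp add: N_def \<tau>_def)
      then have "dist p t0 < \<rho>1" using \<delta> power2_le_imp_le[of "norm (t0 - p)" \<delta>] by (simp add: dist_norm norm_minus_commute)
      then have "c0 < \<alpha> + \<eta>" using \<rho>1(2)[of t0 \<theta>0] t0 c0 by (simp add: z0_def)
      moreover have "\<alpha> \<le> Q t0" using 0 KN by (simp add: Q_def lin_def)
      ultimately show False using lower' \<eta> by linarith
    qed
    have tau_less: "\<tau> t0 < D"
    proof (rule ccontr)
      assume "\<not> \<tau> t0 < D"
      then have D': "\<tau> t0 = D" using taus by simp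
      have "(norm (t0 - q))\<^sup>2 = N t0 + (\<tau> t0 - D)\<^sup>2"
      proof -
        have "t0 - q = (t0 - p) - D *\<^sub>R w" by (simp add: qp)
        then show ?thesis
          unfolding N_def \<tau>_def power2_norm_eq_inner
          by (simp only: inner_diff_left inner_diff_right inner_scaleR_left inner_scaleR_right ww)
            (simp add: inner_commute power2_eq_square algebra_simps)
      qed
      then have "(norm (t0 - q))\<^sup>2 \<le> \<delta>\<^sup>2" using taus D' by simp
      then have "dist q t0 < \<rho>2" using \<delta> power2_le_imp_le[of "norm (t0 - q)" \<delta>] by (simp add: dist_norm norm_minus_commute)
      then have "c0 < \<beta> + \<eta>" using \<rho>2(2)[of t0 \<theta>0] t0 c0 by (simp add: z0_def)
      moreover have "\<beta> - \<eta> \<le> Q t0" using D' D KN \<epsilon> by (simp add: Q_def lin_def)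
      ultimately show False using lower' \<eta> by linarith
    qed
    have N_less: "N t0 < \<delta>\<^sup>2"
    proof (rule ccontr)
      assume "\<not> N t0 < \<delta>\<^sup>2"
      then have "N t0 = \<delta>\<^sup>2" using taus by simp
      moreover have "- (\<bar>\<alpha>\<bar> + \<bar>\<beta>\<bar>) \<le> lin t0"
      proof -
        define \<sigma> where "\<sigma> = \<tau> t0 / D"
        have \<sigma>: "0 \<le> \<sigma>" "\<sigma> \<le> 1" using taus D by (auto simp: \<sigma>_def)
        have "lin t0 = (1 - \<sigma>) * \<alpha> + \<sigma> * \<beta>" by (simp add: lin_def \<sigma>_def algebra_simps add_divide_distrib diff_divide_distrib)
        moreover have "\<bar>(1 - \<sigma>) * \<alpha>\<bar> \<le> \<bar>\<alpha>\<bar>" "\<bar>\<sigma> * \<beta>\<bar> \<le> \<bar>\<beta>\<bar>"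
          using \<sigma> by (auto simp: abs_mult intro!: mult_left_le_one_le)
        ultimately show ?thesis by linarith
      qed
      ultimately have "\<bar>M\<bar> \<le> Q t0" using ets K by (simp add: Q_def)
      moreover have "c0 \<le> M" using M[OF a0] c0 by (simp add: a0_eq z0_def)
      ultimately show False using lower' \<eta> by linarith
    qed
    have "open {t. 0 < \<tau> t \<and> \<tau> t < D \<and> N t < \<delta>\<^sup>2}"
      by (intro open_Collect_conj open_Collect_less continuous_intros cont)
    then obtain d where d: "d > 0" "ball t0 d \<subseteq> {t. 0 < \<tau> t \<and> \<tau> t < D \<and> N t < \<delta>\<^sup>2}"
      using tau_pos tau_less N_less by (metis (mono_tags, lifting) mem_Collect_eq openE)
    \<comment> \<open>The gradient of \<open>Q\<close> at \<open>t0\<close>.\<close>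
    define m where "m = ((\<beta> - \<alpha>) / D - 2 * \<epsilon> * \<tau> t0) *\<^sub>R w + (2 * K) *\<^sub>R ((t0 - p) - \<tau> t0 *\<^sub>R w)"
    have expand: "Q (t0 + s) = Q t0 + (m \<bullet> s - \<epsilon> * (w \<bullet> s)\<^sup>2 + K * ((norm s)\<^sup>2 - (w \<bullet> s)\<^sup>2))" for s
    proof -
      have ts: "\<tau> (t0 + s) = \<tau> t0 + w \<bullet> s" by (simp add: \<tau>_def inner_diff_right inner_add_right)
      have "t0 + s - p = (t0 - p) + s" by simp
      then have Ns: "N (t0 + s) = N t0 + 2 * ((t0 - p) \<bullet> s - \<tau> t0 * (w \<bullet> s)) + ((norm s)\<^sup>2 - (w \<bullet> s)\<^sup>2)"
        unfolding N_def by (simp only: power2_norm_eq_inner inner_add \<tau>_def)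
          (simp add: inner_commute power2_eq_square algebra_simps)
      have ms: "m \<bullet> s = ((\<beta> - \<alpha>) / D - 2 * \<epsilon> * \<tau> t0) * (w \<bullet> s) + 2 * K * ((t0 - p) \<bullet> s - \<tau> t0 * (w \<bullet> s))"
        by (simp add: m_def inner_add_left inner_diff_left)
      define \<kappa> where "\<kappa> = (\<beta> - \<alpha>) / D"
      show ?thesis
        unfolding Q_def lin_def ts Ns ms \<kappa>_def[symmetric] by (simp add: power2_sum algebra_simps)
    qed
    show False
    proof (rule psh_not_touched_by_concave_quadratic[OF u w \<epsilon>(1) K(1) d(1)])
      show "z0 $ k \<noteq> x $ k" for k by (simp add: z0_def torus_point_off_hyperplanes)
      show "u z0 \<noteq> -\<infinity>" using c0 by simp
      fix z s assume z: "\<And>k. z $ k \<noteq> x $ k" and s: "log_coords x z = log_coords x z0 + s" "norm s < d"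
      have lz: "log_coords x z = t0 + s" using s by (simp add: z0_def log_coords_torus_point)
      have "t0 + s \<in> ball t0 d" using s by (simp add: dist_norm)
      then have "t0 + s \<in> Tube" using d by (force simp: Tube_def)
      then have "u z - ereal (Q (t0 + s)) \<le> u z0 - ereal (Q t0)" using big[OF z] lz by simp
      then show "u z \<le> u z0 + ereal (m \<bullet> s - \<epsilon> * (w \<bullet> s)\<^sup>2 + K * ((norm s)\<^sup>2 - (w \<bullet> s)\<^sup>2))"
        unfolding expand by (cases "u z") (auto simp: c0)
    qed
  qed
qed

section \<open>Recession functions of convex functions\<close>

text \<open>
  The supremum of the slopes of \<open>\<gamma>\<close> along the ray through \<open>t\<close>; for convex \<open>\<gamma>\<close> of linear growth
  it is also their limit.
\<close>

definition recession :: "('a::real_vector \<Rightarrow> real) \<Rightarrow> 'a \<Rightarrow> real" where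
  "recession \<gamma> t = (SUP R\<in>{0<..}. (\<gamma> (R *\<^sub>R t) - \<gamma> 0) / R)"

locale convex_linear_growth =
  fixes \<gamma> :: "'a::real_vector \<Rightarrow> real" and B :: "'a \<Rightarrow> real" and A :: real
  assumes convex: "\<And>p q \<mu>. 0 \<le> \<mu> \<Longrightarrow> \<mu> \<le> 1 \<Longrightarrow>
      \<gamma> ((1 - \<mu>) *\<^sub>R p + \<mu> *\<^sub>R q) \<le> (1 - \<mu>) * \<gamma> p + \<mu> * \<gamma> q"
    and growth: "\<And>t R. R > 0 \<Longrightarrow> \<gamma> (R *\<^sub>R t) \<le> A + R * B t"
begin

lemma slope_mono:
  assumes "0 < R" "R \<le> S"
  shows "(\<gamma> (R *\<^sub>R t) - \<gamma> 0) / R \<le> (\<gamma> (S *\<^sub>R t) - \<gamma> 0) / S"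
proof -
  have "\<gamma> (R *\<^sub>R t) \<le> (1 - R / S) * \<gamma> 0 + (R / S) * \<gamma> (S *\<^sub>R t)"
    using convex[of "R / S" 0 "S *\<^sub>R t"] assms by simp
  then show ?thesis using assms by (simp add: field_simps)
qed

text \<open>
  The constant \<open>A - \<gamma> 0\<close> in the growth bound is divided by arbitrarily large \<open>S\<close>.
\<close>

lemma slope_le:
  assumes "0 < R"
  shows "(\<gamma> (R *\<^sub>R t) - \<gamma> 0) / R \<le> B t"
proof (rule tendsto_lowerbound)
  show "((\<lambda>S. B t + (A - \<gamma> 0) / S) \<longlongrightarrow> B t) at_top"
    by (rule tendsto_eq_intros tendsto_divide_0[OF tendsto_const filterlim_at_top_imp_at_infinity] filterlim_ident refl | simp)+
  show "\<forall>\<^sub>F S in at_top. (\<gamma> (R *\<^sub>R t) - \<gamma> 0) / R \<le> B t + (A - \<gamma> 0) / S"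
    using eventually_ge_at_top[of R]
  proof eventually_elim
    case (elim S)
    then have "(\<gamma> (R *\<^sub>R t) - \<gamma> 0) / R \<le> (\<gamma> (S *\<^sub>R t) - \<gamma> 0) / S" using assms by (intro slope_mono)
    also have "\<dots> \<le> (A + S * B t - \<gamma> 0) / S"
      using growth[of S t] elim assms by (intro divide_right_mono) auto
    also have "\<dots> = B t + (A - \<gamma> 0) / S" using elim assms by (simp add: field_simps)
    finally show ?case .
  qed
qed simp

lemma slope_le_recession:
  assumes "0 < R"
  shows "(\<gamma> (R *\<^sub>R t) - \<gamma> 0) / R \<le> recession \<gamma> t"
  unfolding recession_def
proof (rule cSUP_upper)
  show "bdd_above ((\<lambda>R. (\<gamma> (R *\<^sub>R t) - \<gamma> 0) / R) ` {0<..})"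
    by (rule bdd_aboveI2[of _ _ "B t"]) (simp add: slope_le)
qed (use assms in simp)

lemma le_recession: "\<gamma> t \<le> \<gamma> 0 + recession \<gamma> t"
  using slope_le_recession[of 1 t] by simp

lemma recession_le: "recession \<gamma> t \<le> B t"
  unfolding recession_def by (rule cSUP_least) (auto simp: slope_le)

lemma recession_limit: "((\<lambda>R. \<gamma> (R *\<^sub>R t) / R) \<longlongrightarrow> recession \<gamma> t) at_top"
proof -
  have "((\<lambda>R. (\<gamma> (R *\<^sub>R t) - \<gamma> 0) / R) \<longlongrightarrow> recession \<gamma> t) at_top"
  proof (rule order_tendstoI)
    fix a assume "a < recession \<gamma> t"
    then obtain R where R: "0 < R" "a < (\<gamma> (R *\<^sub>R t) - \<gamma> 0) / R"
      unfolding recession_def by (subst (asm) less_cSUP_iff) (auto intro: bdd_aboveI2 slope_le)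
    show "\<forall>\<^sub>F S in at_top. a < (\<gamma> (S *\<^sub>R t) - \<gamma> 0) / S"
      using eventually_ge_at_top[of R] by eventually_elim (rule less_le_trans[OF R(2) slope_mono[OF R(1)]])
  next
    fix a assume less: "recession \<gamma> t < a"
    show "\<forall>\<^sub>F S in at_top. (\<gamma> (S *\<^sub>R t) - \<gamma> 0) / S < a"
      using eventually_gt_at_top[of 0] by eventually_elim (rule le_less_trans[OF slope_le_recession less])
  qed
  moreover have "((\<lambda>R. \<gamma> 0 / R) \<longlongrightarrow> 0) at_top"
    by (rule tendsto_divide_0[OF tendsto_const filterlim_at_top_imp_at_infinity[OF filterlim_ident]])
  ultimately have "((\<lambda>R. (\<gamma> (R *\<^sub>R t) - \<gamma> 0) / R + \<gamma> 0 / R) \<longlongrightarrow> recession \<gamma> t + 0) at_top"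
    by (rule tendsto_add)
  then show ?thesis by (simp add: diff_divide_distrib)
qed

lemma recession_homogeneous:
  assumes c: "c > 0"
  shows "recession \<gamma> (c *\<^sub>R t) = c * recession \<gamma> t"
proof -
  have "LIM R at_top. c * R :> at_top"
    by (rule filterlim_tendsto_pos_mult_at_top[OF tendsto_const c filterlim_ident])
  then have "((\<lambda>R. \<gamma> ((c * R) *\<^sub>R t) / (c * R)) \<longlongrightarrow> recession \<gamma> t) at_top"
    by (rule filterlim_compose[OF recession_limit])
  then have "((\<lambda>R. c * (\<gamma> ((c * R) *\<^sub>R t) / (c * R))) \<longlongrightarrow> c * recession \<gamma> t) at_top"
    by (intro tendsto_mult tendsto_const)
  also have "(\<lambda>R. c * (\<gamma> ((c * R) *\<^sub>R t) / (c * R))) = (\<lambda>R. \<gamma> (R *\<^sub>R c *\<^sub>R t) / R)"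
    using c by (simp add: mult.commute)
  finally show ?thesis by (intro tendsto_unique[OF _ recession_limit]) simp_all
qed

lemma recession_subadditive: "recession \<gamma> (s + t) \<le> recession \<gamma> s + recession \<gamma> t"
proof (rule tendsto_le[OF _ _ recession_limit])
  have "LIM R at_top. 2 * (R::real) :> at_top"
    by (rule filterlim_tendsto_pos_mult_at_top[OF tendsto_const _ filterlim_ident]) simp
  then show "((\<lambda>R. \<gamma> ((2 * R) *\<^sub>R s) / (2 * R) + \<gamma> ((2 * R) *\<^sub>R t) / (2 * R))
      \<longlongrightarrow> recession \<gamma> s + recession \<gamma> t) at_top"
    by (intro tendsto_add filterlim_compose[OF recession_limit])
  show "\<forall>\<^sub>F R in at_top. \<gamma> (R *\<^sub>R (s + t)) / R \<le> \<gamma> ((2 * R) *\<^sub>R s) / (2 * R) + \<gamma> ((2 * R) *\<^sub>R t) / (2 * R)"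
    using eventually_gt_at_top[of 0]
  proof eventually_elim
    case (elim R)
    have "\<gamma> (R *\<^sub>R (s + t)) \<le> (1/2) * \<gamma> ((2 * R) *\<^sub>R s) + (1/2) * \<gamma> ((2 * R) *\<^sub>R t)"
      using convex[of "1/2" "(2 * R) *\<^sub>R s" "(2 * R) *\<^sub>R t"] by (simp add: scaleR_add_right)
    then show ?case using elim by (simp add: field_simps)
  qed
qed simp

end

section \<open>Indicators of sublinear functions\<close>

text \<open>
  The convex images of indicators: finite sublinear functions bounded by a multiple of the
  largest positive coordinate.
\<close>

locale sublinear_growth =
  fixes \<psi> :: "real ^ 'n::finite \<Rightarrow> real" and C :: real
  assumes homogeneous: "\<And>c t. c > 0 \<Longrightarrow> \<psi> (c *\<^sub>R t) = c * \<psi> t"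
    and subadditive: "\<And>s t. \<psi> (s + t) \<le> \<psi> s + \<psi> t"
    and growth: "\<And>M t. 0 \<le> M \<Longrightarrow> (\<And>k. t $ k \<le> M) \<Longrightarrow> \<psi> t \<le> C * M"
    and C_nonneg: "0 \<le> C"
begin

text \<open>
  Here \<open>s - t\<close> has no positive coordinate, so the growth bound with \<open>M = 0\<close> gives \<open>\<psi> (s - t) \<le>
  0\<close>.
\<close>

lemma mono:
  assumes "\<And>k. s $ k \<le> t $ k"
  shows "\<psi> s \<le> \<psi> t"
  using subadditive[of t "s - t"] growth[of 0 "s - t"] assms by simp

lemma at_zero: "\<psi> 0 = 0"
  using homogeneous[of 2 0] by simp

text \<open>
  A hyperplane separating \<open>(t0, \<psi> t0)\<close> from the strict epigraph is the graph of an affine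
  minorant touching at \<open>t0\<close>; homogeneity makes it linear, and \<open>\<psi> \<le> 0\<close> on the negative orthant
  makes its coefficients nonnegative.
\<close>

lemma supporting_functional:
  obtains m where "\<And>k. 0 \<le> m $ k" "\<psi> t0 = m \<bullet> t0" "\<And>t. m \<bullet> t \<le> \<psi> t"
proof -
  let ?T = "{p. \<psi> (fst p) < snd p} :: ((real ^ 'n) \<times> real) set"
  have conv: "convex ?T"
    unfolding convex_def
  proof (intro ballI allI impI)
    fix p q :: "(real ^ 'n) \<times> real" and a b :: real
    assume pq: "p \<in> ?T" "q \<in> ?T" and ab: "0 \<le> a" "0 \<le> b" "a + b = 1"
    have h: "\<psi> (c *\<^sub>R t) = c * \<psi> t" if "c \<ge> 0" for c t
      using that homogeneous[of c t] at_zero by (cases "c = 0") auto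
    have "\<psi> (a *\<^sub>R fst p + b *\<^sub>R fst q) \<le> a * \<psi> (fst p) + b * \<psi> (fst q)"
      using subadditive[of "a *\<^sub>R fst p" "b *\<^sub>R fst q"] ab by (simp add: h)
    also have "\<dots> < a * snd p + b * snd q"
    proof (cases "a = 0")
      case True
      then show ?thesis using ab pq by simp
    next
      case False
      then have "a * \<psi> (fst p) < a * snd p" using ab pq by simp
      moreover have "b * \<psi> (fst q) \<le> b * snd q" using ab pq by (intro mult_left_mono) auto
      ultimately show ?thesis by (rule add_less_le_mono)
    qed
    finally show "a *\<^sub>R p + b *\<^sub>R q \<in> ?T" by simp
  qed
  have "(t0, \<psi> t0 + 1) \<in> ?T" by simp
  then have "?T \<noteq> {}" by blast
  moreover have "{(t0, \<psi> t0)} \<inter> ?T = {}" by simp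
  ultimately obtain v b where v: "v \<noteq> 0" "v \<bullet> (t0, \<psi> t0) \<le> b" and b: "\<And>p. p \<in> ?T \<Longrightarrow> b \<le> v \<bullet> p"
    using separating_hyperplane_sets[OF convex_singleton conv, of "(t0, \<psi> t0)"] by auto
  obtain a \<alpha> where va: "v = (a, \<alpha>)" by (cases v)
  have sep: "a \<bullet> t0 + \<alpha> * \<psi> t0 \<le> a \<bullet> t + \<alpha> * s" if "\<psi> t < s" for t s
    using v(2) b[of "(t, s)"] that by (simp add: va)
  have "0 \<le> \<alpha>" using sep[of t0 "\<psi> t0 + 1"] by (simp add: algebra_simps)
  moreover have "\<alpha> \<noteq> 0"
  proof
    assume "\<alpha> = 0"
    then have "a \<bullet> a \<le> 0" using sep[of "t0 - a" "\<psi> (t0 - a) + 1"] by (simp add: inner_diff_right)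
    then have "a \<bullet> a = 0" by (intro antisym) simp_all
    then have "a = 0" by simp
    then show False using v(1) va \<open>\<alpha> = 0\<close> by (simp add: zero_prod_def)
  qed
  ultimately have \<alpha>: "\<alpha> > 0" by simp
  define m where "m = (- 1 / \<alpha>) *\<^sub>R a"
  have sub: "\<psi> t0 + m \<bullet> (t - t0) \<le> \<psi> t" for t
  proof (rule dense_ge)
    fix s assume "\<psi> t < s"
    from sep[OF this] show "\<psi> t0 + m \<bullet> (t - t0) \<le> s"
      using \<alpha> by (simp add: m_def inner_diff_right field_simps)
  qed
  have eq: "\<psi> t0 = m \<bullet> t0"
    using sub[of 0] sub[of "2 *\<^sub>R t0"] homogeneous[of 2 t0] at_zero by (simp add: inner_diff_right)
  have le: "m \<bullet> t \<le> \<psi> t" for t using sub[of t] eq by (simp add: inner_diff_right)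
  have "0 \<le> m $ k" for k
  proof -
    have "- (m $ k) = m \<bullet> (- axis k 1)" by (simp add: inner_axis)
    also have "\<dots> \<le> \<psi> (- axis k 1)" by (rule le)
    also have "\<dots> \<le> C * 0" by (rule growth) (auto simp: axis_def)
    finally show ?thesis by simp
  qed
  with eq le show ?thesis using that by blast
qed

text \<open>
  The strict inequalities make the sublevel sets unions of open polydiscs, so that
  semicontinuity is built in. Monotonicity of \<open>\<psi>\<close> makes the infimum the value \<open>\<psi> (log |y\<^sub>1|, \<dots>,
  log |y\<^sub>n|)\<close> when no coordinate vanishes.
\<close>

definition extension :: "complex ^ 'n \<Rightarrow> ereal" where
  "extension y = (INF t\<in>{t. \<forall>k. cmod (y $ k) < exp (t $ k)}. ereal (\<psi> t))"

lemma extension_le: "(\<And>k. cmod (y $ k) < exp (t $ k)) \<Longrightarrow> extension y \<le> ereal (\<psi> t)"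
  unfolding extension_def by (intro INF_lower) simp

lemma extension_le_growth:
  assumes "0 \<le> M" "\<And>k. cmod (y $ k) < exp M"
  shows "extension y \<le> ereal (C * M)"
proof -
  have "extension y \<le> ereal (\<psi> (\<chi> k. M))" using assms by (intro extension_le) simp
  also have "\<dots> \<le> ereal (C * M)" using growth[of M "\<chi> k. M"] assms by simp
  finally show ?thesis .
qed

lemma extension_mono:
  assumes "\<And>k. cmod (y $ k) \<le> cmod (y' $ k)"
  shows "extension y \<le> extension y'"
  unfolding extension_def[of y'] using assms
  by (intro INF_greatest extension_le) (auto intro: le_less_trans)

lemma extension_off_hyperplanes:
  assumes y: "\<And>k. y $ k \<noteq> 0"
  shows "extension y = ereal (\<psi> (log_coords 0 y))"
proof (rule antisym)
  show "extension y \<le> ereal (\<psi> (log_coords 0 y))"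
  proof (rule ereal_le_epsilon2)
    fix e :: real assume e: "0 < e"
    define d where "d = e / (C + 1)"
    have d: "d > 0" "C * d \<le> e" using e C_nonneg by (auto simp: d_def field_simps)
    have "extension y \<le> ereal (\<psi> (log_coords 0 y + (\<chi> k. d)))"
      using y d by (intro extension_le) (simp add: log_coords_def exp_add)
    also have "\<psi> (log_coords 0 y + (\<chi> k. d)) \<le> \<psi> (log_coords 0 y) + \<psi> (\<chi> k. d)" by (rule subadditive)
    also have "\<psi> (\<chi> k. d) \<le> e" using growth[of d "\<chi> k. d"] d by simp
    finally show "extension y \<le> ereal (\<psi> (log_coords 0 y)) + ereal e" by simp
  qed
  show "ereal (\<psi> (log_coords 0 y)) \<le> extension y"
    unfolding extension_def
  proof (rule INF_greatest)
    fix t assume t: "t \<in> {t. \<forall>k. cmod (y $ k) < exp (t $ k)}"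
    have "\<psi> (log_coords 0 y) \<le> \<psi> t"
    proof (rule mono)
      fix k
      have "ln (cmod (y $ k)) \<le> ln (exp (t $ k))" using t y[of k] by (intro ln_mono) (auto intro: less_imp_le)
      then show "log_coords 0 y $ k \<le> t $ k" by (simp add: log_coords_def)
    qed
    then show "ereal (\<psi> (log_coords 0 y)) \<le> ereal (\<psi> t)" by simp
  qed
qed

lemma extension_usc: "upper_semicontinuous extension"
  unfolding upper_semicontinuous_def
proof
  fix c
  have "{z. extension z < c} = (\<Union>t\<in>{t. ereal (\<psi> t) < c}. {z. \<forall>k. cmod (z $ k) < exp (t $ k)})"
    by (auto simp: extension_def INF_less_iff)
  moreover have "open {z :: complex ^ 'n. \<forall>k. cmod (z $ k) < exp (t $ k)}" for t :: "real ^ 'n"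
  proof -
    have "open (\<Inter>k. {z :: complex ^ 'n. cmod (z $ k) < exp (t $ k)})"
      by (intro open_INT ballI open_Collect_less continuous_intros) simp
    moreover have "(\<Inter>k. {z. cmod (z $ k) < exp (t $ k)}) = {z :: complex ^ 'n. \<forall>k. cmod (z $ k) < exp (t $ k)}"
      by auto
    ultimately show ?thesis by simp
  qed
  ultimately show "open {z. extension z < c}" by (simp add: open_UN)
qed

text \<open>
  When \<open>|a\<^sub>k| \<noteq> |b\<^sub>k|\<close> for all \<open>k\<close>, the circle misses the coordinate hyperplanes. A linear
  minorant of \<open>\<psi>\<close> touching at \<open>log |a|\<close> then bounds the extension below by \<open>\<Sum> m\<^sub>k ln |a\<^sub>k + b\<^sub>k
  \<zeta>|\<close>, whose mean is at least its value at the centre since \<open>m\<^sub>k \<ge> 0\<close>.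
\<close>

lemma extension_submean_generic:
  assumes a: "\<And>k. a $ k \<noteq> 0" and ab: "\<And>k. cmod (a $ k) \<noteq> cmod (b $ k)"
  shows "extension a \<le> circle_mean (\<lambda>\<zeta>. extension (a + \<zeta> *s b))"
proof -
  obtain m where m: "\<And>k. 0 \<le> m $ k" "\<psi> (log_coords 0 a) = m \<bullet> log_coords 0 a" "\<And>t. m \<bullet> t \<le> \<psi> t"
    using supporting_functional by blast
  have "\<exists>H. ((\<lambda>\<theta>. ln (cmod (a $ k + cis \<theta> * b $ k))) has_integral H) {0..2*pi} \<and> 2*pi * ln (cmod (a $ k)) \<le> H" for k
    using ln_cmod_circle_submean[OF a ab] by metis
  then obtain H where H: "\<And>k. ((\<lambda>\<theta>. ln (cmod (a $ k + cis \<theta> * b $ k))) has_integral H k) {0..2*pi}"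
    "\<And>k. 2*pi * ln (cmod (a $ k)) \<le> H k" by metis
  have ne: "a $ k + cis \<theta> * b $ k \<noteq> 0" for k \<theta>
  proof
    assume "a $ k + cis \<theta> * b $ k = 0"
    then have "a $ k = - (cis \<theta> * b $ k)" by (rule eq_neg_iff_add_eq_0[THEN iffD2])
    then show False using ab[of k] by (simp add: norm_mult)
  qed
  define h where "h = (\<lambda>\<theta>. \<Sum>k\<in>UNIV. m $ k * ln (cmod (a $ k + cis \<theta> * b $ k)))"
  have int: "(h has_integral (\<Sum>k\<in>UNIV. m $ k * H k)) {0..2*pi}"
    unfolding h_def by (intro has_integral_sum has_integral_mult_right H) simp
  have cont: "continuous_on {0..2*pi} h"
    unfolding h_def using ne by (intro continuous_intros) auto
  have "extension a = ereal (m \<bullet> log_coords 0 a)" using extension_off_hyperplanes[of a] a m by simp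
  also have "\<dots> \<le> ereal ((\<Sum>k\<in>UNIV. m $ k * H k) / (2*pi))"
  proof -
    have "(\<Sum>k\<in>UNIV. m $ k * (2*pi * ln (cmod (a $ k)))) \<le> (\<Sum>k\<in>UNIV. m $ k * H k)"
      by (intro sum_mono mult_left_mono H m)
    then have "2*pi * (m \<bullet> log_coords 0 a) \<le> (\<Sum>k\<in>UNIV. m $ k * H k)"
      by (simp add: inner_vec_def log_coords_def sum_distrib_left mult_ac)
    then show ?thesis by (simp add: field_simps)
  qed
  also have "\<dots> \<le> circle_mean (\<lambda>\<zeta>. extension (a + \<zeta> *s b))"
  proof (rule circle_mean_ge[OF int cont])
    fix \<theta>
    have "h \<theta> = m \<bullet> log_coords 0 (a + cis \<theta> *s b)"
      by (simp add: h_def inner_vec_def log_coords_def)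
    also have "\<dots> \<le> \<psi> (log_coords 0 (a + cis \<theta> *s b))" by (rule m)
    finally show "ereal (h \<theta>) \<le> extension (a + cis \<theta> *s b)"
      using extension_off_hyperplanes[of "a + cis \<theta> *s b"] ne by simp
  qed
  finally show ?thesis .
qed

text \<open>
  Generic circles approximate every circle: the vanishing coordinates of the centre are replaced
  by \<open>e j\<close> and the direction is dilated by \<open>1 + e j\<close>, where \<open>e j\<close> tends to 0. The new centres
  have larger moduli, so monotonicity keeps the extension at them above its value at \<open>a\<close>.
\<close>

lemma extension_submean: "extension a \<le> circle_mean (\<lambda>\<zeta>. extension (a + \<zeta> *s b))"
proof -
  define e where "e = (\<lambda>j. inverse (real (Suc j)))"
  have e0: "e \<longlonglongrightarrow> 0" unfolding e_def by (rule LIMSEQ_inverse_real_of_nat)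
  have e1: "0 < e j" "e j \<le> 1" for j by (auto simp: e_def inverse_eq_divide)
  define P where "P = (\<lambda>j. \<chi> k. if a $ k = 0 then complex_of_real (e j) else a $ k)"
  define Q where "Q = (\<lambda>j. complex_of_real (1 + e j) *s b)"
  have Pk: "cmod (P j $ k) = (if a $ k = 0 then e j else cmod (a $ k))" for j k
    using e1[of j] by (simp add: P_def)
  have Qk: "cmod (Q j $ k) = (1 + e j) * cmod (b $ k)" for j k
    using e1[of j] by (simp add: Q_def norm_mult del: of_real_add)
  have small: "\<forall>\<^sub>F j in sequentially. e j < d" if "d > 0" for d
    using order_tendstoD(2)[OF e0 that] .
  \<comment> \<open>The dilation separates equal nonzero moduli, the new coordinate \<open>e j\<close> of the centre
    separates two zeros, and unequal moduli stay apart once \<open>e j\<close> is small.\<close>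
  have "\<forall>\<^sub>F j in sequentially. cmod (P j $ k) \<noteq> cmod (Q j $ k)" for k
  proof (cases "b $ k = 0")
    case True
    then show ?thesis using e1 by (simp add: Pk Qk less_imp_neq[symmetric])
  next
    case b: False
    show ?thesis
    proof (cases "cmod (a $ k) \<le> cmod (b $ k)")
      case True
      have "\<forall>\<^sub>F j in sequentially. e j < cmod (b $ k)" using b by (intro small) simp
      then show ?thesis
      proof eventually_elim
        case (elim j)
        have "cmod (b $ k) < (1 + e j) * cmod (b $ k)" using e1[of j] b by simp
        then show ?case using elim True by (auto simp: Pk Qk)
      qed
    next
      case False
      then have "\<forall>\<^sub>F j in sequentially. e j < (cmod (a $ k) - cmod (b $ k)) / cmod (b $ k)"
        using b by (intro small) simp
      then show ?thesis
      proof eventually_elim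
        case (elim j)
        then have "e j * cmod (b $ k) < cmod (a $ k) - cmod (b $ k)" using b by (simp add: pos_less_divide_eq)
        moreover have "a $ k \<noteq> 0" using False by auto
        ultimately show ?case by (simp add: Pk Qk algebra_simps)
      qed
    qed
  qed
  then have "\<forall>\<^sub>F j in sequentially. \<forall>k. cmod (P j $ k) \<noteq> cmod (Q j $ k)" by (rule eventually_all_finite)
  then obtain N where N: "\<And>j k. N \<le> j \<Longrightarrow> cmod (P j $ k) \<noteq> cmod (Q j $ k)"
    by (auto simp: eventually_sequentially)
  define S where "S = norm a + 1 + 2 * norm b"
  have bound: "extension (p + cis \<theta> *s q) \<le> ereal (C * ln (S + 1))"
    if "\<And>k. cmod (p $ k) \<le> norm a + 1" "\<And>k. cmod (q $ k) \<le> 2 * norm b" for p q \<theta>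
  proof (rule extension_le_growth)
    show "0 \<le> ln (S + 1)" by (simp add: S_def)
    fix k
    have "cmod ((p + cis \<theta> *s q) $ k) \<le> cmod (p $ k) + cmod (q $ k)"
      using norm_triangle_ineq[of "p $ k" "cis \<theta> * q $ k"] by (simp add: norm_mult)
    also have "\<dots> < S + 1" using that[of k] by (simp add: S_def)
    also have "\<dots> = exp (ln (S + 1))"
    proof -
      have "0 < S + 1" using norm_ge_zero[of a] norm_ge_zero[of b] unfolding S_def by linarith
      then show ?thesis by simp
    qed
    finally show "cmod ((p + cis \<theta> *s q) $ k) < exp (ln (S + 1))" .
  qed
  have ak: "cmod (a $ k) \<le> norm a + 1" "cmod (b $ k) \<le> 2 * norm b" for k
    using Finite_Cartesian_Product.norm_nth_le[of a k] Finite_Cartesian_Product.norm_nth_le[of b k] norm_ge_zero[of b] by linarith+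
  show ?thesis
  proof (rule circle_mean_usc_limit[OF extension_usc])
    have "(\<lambda>j. P j $ k) \<longlonglongrightarrow> a $ k" for k
      using tendsto_of_real[OF e0, where 'a = complex] by (cases "a $ k = 0") (auto simp: P_def)
    then have "P \<longlonglongrightarrow> a" by (rule vec_tendstoI)
    then show "(\<lambda>j. P (j + N)) \<longlonglongrightarrow> a" by (rule LIMSEQ_ignore_initial_segment)
    have "(\<lambda>j. Q j $ k) \<longlonglongrightarrow> (1 + 0) * b $ k" for k
      unfolding Q_def vector_smult_component of_real_add of_real_1
      using tendsto_of_real[OF e0, where 'a = complex] by (intro tendsto_intros) auto
    then have "Q \<longlonglongrightarrow> b" by (intro vec_tendstoI) simp
    then show "(\<lambda>j. Q (j + N)) \<longlonglongrightarrow> b" by (rule LIMSEQ_ignore_initial_segment)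
    show "extension a \<le> circle_mean (\<lambda>\<zeta>. extension (P (j + N) + \<zeta> *s Q (j + N)))" for j
    proof -
      have "extension a \<le> extension (P (j + N))" using e1 by (intro extension_mono) (simp add: Pk less_imp_le)
      also have "\<dots> \<le> circle_mean (\<lambda>\<zeta>. extension (P (j + N) + \<zeta> *s Q (j + N)))"
        using N e1 by (intro extension_submean_generic) (auto simp: P_def less_imp_neq[symmetric])
      finally show ?thesis .
    qed
    show "extension (P (j + N) + cis \<theta> *s Q (j + N)) \<le> ereal (C * ln (S + 1))" for j \<theta>
    proof (rule bound)
      show "cmod (P (j + N) $ k) \<le> norm a + 1" for k using ak[of k] e1[of "j + N"] by (auto simp: Pk add_increasing)
      show "cmod (Q (j + N) $ k) \<le> 2 * norm b" for k
        using Finite_Cartesian_Product.norm_nth_le[of b k] e1[of "j + N"] unfolding Qk by (intro mult_mono) auto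
    qed
    show "extension (a + cis \<theta> *s b) \<le> ereal (C * ln (S + 1))" for \<theta> by (rule bound) (rule ak)+
    show "extension a \<noteq> \<infinity>"
    proof -
      have "extension (a + cis 0 *s 0) \<le> ereal (C * ln (S + 1))" by (rule bound) (use ak in auto)
      then show ?thesis by auto
    qed
  qed
qed

lemma extension_in_indicators: "extension \<in> indicators"
proof -
  \<comment> \<open>The summand \<open>ln 2\<close> makes the inequality between moduli strict.\<close>
  have grow: "extension z \<le> ereal (C * max 0 (ln (norm z)) + C * ln 2)" for z
  proof -
    have "extension z \<le> ereal (C * (max 0 (ln (norm z)) + ln 2))"
    proof (rule extension_le_growth)
      fix k
      have "norm z \<le> exp (max 0 (ln (norm z)))"
      proof (cases "z = 0")
        case False
        then have "norm z = exp (ln (norm z))" by simp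
        also have "\<dots> \<le> exp (max 0 (ln (norm z)))" by (subst exp_le_cancel_iff) simp
        finally show ?thesis .
      qed simp
      then have "cmod (z $ k) \<le> exp (max 0 (ln (norm z)))"
        using Finite_Cartesian_Product.norm_nth_le[of z k] by linarith
      also have "\<dots> < exp (max 0 (ln (norm z)) + ln 2)" by simp
      finally show "cmod (z $ k) < exp (max 0 (ln (norm z)) + ln 2)" .
    qed simp
    then show ?thesis by (simp add: algebra_simps)
  qed
  have image: "convex_image extension t = ereal (\<psi> t)" for t
    unfolding convex_image_def by (subst extension_off_hyperplanes) (auto simp: log_coords_def)
  have "psh extension"
    unfolding psh_def
  proof (intro conjI allI)
    show "extension z \<noteq> \<infinity>" for z using grow[of z] by auto
    show "\<exists>z. extension z \<noteq> -\<infinity>" using image[of 0] by (metis MInfty_neq_ereal(1) convex_image_def)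
  qed (rule extension_usc extension_submean)+
  moreover have "circled extension"
    by (simp add: circled_def extension_def)
  moreover have "\<exists>C\<^sub>1 C\<^sub>2 :: real. C\<^sub>1 \<ge> 0 \<and> C\<^sub>2 \<ge> 0 \<and>
      (\<forall>z. extension z \<le> ereal (C\<^sub>1 * max 0 (ln (norm z)) + C\<^sub>2))"
    by (rule exI[of _ C], rule exI[of _ "C * ln 2"]) (use grow C_nonneg in auto)
  ultimately show ?thesis
    unfolding indicators_def lelong_class_def by (simp add: image homogeneous)
qed

end

section \<open>The indicator of a function of logarithmic growth\<close>

lemma torus_max_growth:
  fixes u :: "complex ^ 'n::finite \<Rightarrow> ereal"
  assumes u: "\<And>z. u z \<le> ereal (C\<^sub>1 * max 0 (ln (norm z)) + C\<^sub>2)" and C: "0 \<le> C\<^sub>1"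
    and M: "0 \<le> M" "\<And>k. t $ k \<le> M"
  shows "torus_max u x t \<le> ereal (C\<^sub>1 * ln (norm x + CARD('n)) + C\<^sub>2 + C\<^sub>1 * M)"
  unfolding torus_max_def
proof (rule SUP_least, clarify)
  fix z assume z: "\<forall>k. cmod (z $ k - x $ k) = exp (t $ k)"
  let ?S = "norm x + real CARD('n)"
  have S: "1 \<le> ?S" using norm_ge_zero[of x] by (simp add: Suc_le_eq add_increasing)
  have "norm (z - x) \<le> (\<Sum>k\<in>UNIV. cmod ((z - x) $ k))"
    unfolding norm_vec_def by (intro L2_set_le_sum) simp
  also have "\<dots> \<le> (\<Sum>k\<in>(UNIV::'n set). exp M)" using z M by (intro sum_mono) simp
  finally have "norm (z - x) \<le> CARD('n) * exp M" by simp
  moreover have "norm x \<le> norm x * exp M" using M by (simp add: mult_left_le_one_le mult_le_cancel_left1)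
  ultimately have nz: "norm z \<le> ?S * exp M"
    using norm_triangle_ineq[of x "z - x"] by (simp add: algebra_simps)
  have "ln (norm z) \<le> ln ?S + M"
  proof (cases "z = 0")
    case True
    then show ?thesis using S M by simp
  next
    case False
    then have "ln (norm z) \<le> ln (?S * exp M)" using nz by (intro ln_mono) auto
    also have "\<dots> = ln ?S + M" using S by (subst ln_mult) auto
    finally show ?thesis .
  qed
  moreover have "0 \<le> ln ?S" using S by simp
  ultimately have "C\<^sub>1 * max 0 (ln (norm z)) \<le> C\<^sub>1 * (ln ?S + M)"
    using C M by (intro mult_left_mono) auto
  then show "u z \<le> ereal (C\<^sub>1 * ln ?S + C\<^sub>2 + C\<^sub>1 * M)"
    using u[of z] by (intro order_trans[OF u[of z]]) (simp add: algebra_simps)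
qed

text \<open>
  If \<open>g p = -\<infinity>\<close>, convexity on the segment from \<open>p\<close> through \<open>t\<close> to \<open>2 t - p\<close> forces \<open>g t = -\<infinity>\<close>
  for every \<open>t\<close>. Then \<open>u\<close> is \<open>-\<infinity>\<close> off the hyperplanes, hence everywhere.
\<close>

lemma torus_max_not_MInfty:
  fixes u :: "complex ^ 'n::finite \<Rightarrow> ereal"
  assumes u: "psh u" and fin: "\<And>t. torus_max u x t \<noteq> \<infinity>"
  shows "torus_max u x p \<noteq> -\<infinity>"
proof
  assume p: "torus_max u x p = -\<infinity>"
  have all: "torus_max u x t = -\<infinity>" for t
  proof -
    obtain \<beta> where \<beta>: "torus_max u x (2 *\<^sub>R t - p) \<le> ereal \<beta>"
      using fin[of "2 *\<^sub>R t - p"] by (cases "torus_max u x (2 *\<^sub>R t - p)") auto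
    have t: "t = (1 - 1/2) *\<^sub>R p + (1/2) *\<^sub>R (2 *\<^sub>R t - p)" by (simp add: algebra_simps)
    have "torus_max u x t \<le> ereal r" for r
      using torus_max_convex_combination[OF u _ \<beta>, of p "2 * r - \<beta>" "1/2"] p t by (simp add: field_simps)
    then show ?thesis by (rule ereal_bot)
  qed
  have "u z \<le> -\<infinity>" for z
  proof (rule psh_le_usc_off_hyperplanes[OF u])
    show "upper_semicontinuous (\<lambda>_ :: complex ^ 'n. -\<infinity>)" by (simp add: upper_semicontinuous_def)
    show "u z \<le> -\<infinity>" if "\<And>k. z $ k \<noteq> x $ k" for z
      using le_torus_max[of z x u] that all by simp
  qed
  then show False using u by (auto simp: psh_def)
qed

lemma circled_eq_convex_image:
  assumes "circled \<Phi>" "\<And>k. y $ k \<noteq> 0"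
  shows "\<Phi> y = convex_image \<Phi> (log_coords 0 y)"
  using assms by (simp add: circled_def convex_image_def log_coords_def)

lemma log_coords_shift: "log_coords 0 (z - x) = log_coords x z"
  by (simp add: log_coords_def)

theorem theorem1:
  fixes u :: "complex ^ 'n::finite \<Rightarrow> ereal" and x :: "complex ^ 'n"
  assumes "u \<in> lelong_class"
  shows "(\<exists>C::real. ereal C = torus_max u x 0 \<and>
            (\<forall>z. u z \<le> indicator_at u x (z - x) + ereal C)) \<and>
         indicator_at u x \<in> indicators \<and>
         (\<forall>\<Phi>\<in>indicators.
            (\<exists>C'::real. \<forall>z. u z \<le> \<Phi> (z - x) + ereal C') \<longrightarrow>
            (\<forall>y. indicator_at u x y \<le> \<Phi> y))"
proof -
  obtain C\<^sub>1 C\<^sub>2 where u: "psh u" and C: "0 \<le> C\<^sub>1"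
    and bound: "\<And>z. u z \<le> ereal (C\<^sub>1 * max 0 (ln (norm z)) + C\<^sub>2)"
    using assms by (auto simp: lelong_class_def)
  define A where "A = C\<^sub>1 * ln (norm x + CARD('n)) + C\<^sub>2"
  define top_coord where "top_coord = (\<lambda>t :: real ^ 'n. Max (insert 0 (range (\<lambda>k. t $ k))))"
  have top: "0 \<le> top_coord t" "t $ k \<le> top_coord t" for t k
    unfolding top_coord_def by (intro Max_ge; simp)+
  have grow: "torus_max u x t \<le> ereal (A + C\<^sub>1 * M)" if "0 \<le> M" "\<And>k. t $ k \<le> M" for t M
    unfolding A_def by (rule torus_max_growth[OF bound C that])
  have fin: "torus_max u x t \<noteq> \<infinity>" for t using grow[of "top_coord t" t] top by auto
  define \<gamma> where "\<gamma> = (\<lambda>t. real_of_ereal (torus_max u x t))"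
  have \<gamma>: "torus_max u x t = ereal (\<gamma> t)" for t
    using fin[of t] torus_max_not_MInfty[OF u fin, of t] by (cases "torus_max u x t") (auto simp: \<gamma>_def)
  interpret \<gamma>: convex_linear_growth \<gamma> "\<lambda>t. C\<^sub>1 * top_coord t" A
  proof
    fix p q :: "real ^ 'n" and \<mu> :: real assume "0 \<le> \<mu>" "\<mu> \<le> 1"
    then show "\<gamma> ((1 - \<mu>) *\<^sub>R p + \<mu> *\<^sub>R q) \<le> (1 - \<mu>) * \<gamma> p + \<mu> * \<gamma> q"
      using torus_max_convex_combination[OF u, of x p "\<gamma> p" q "\<gamma> q" \<mu>] by (simp add: \<gamma>)
  next
    fix t :: "real ^ 'n" and R :: real assume R: "0 < R"
    then show "\<gamma> (R *\<^sub>R t) \<le> A + R * (C\<^sub>1 * top_coord t)"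
      using grow[of "R * top_coord t" "R *\<^sub>R t"] top by (simp add: \<gamma> mult_ac)
  qed
  define \<psi> where "\<psi> = recession \<gamma>"
  interpret \<psi>: sublinear_growth \<psi> C\<^sub>1
  proof
    fix M and t :: "real ^ 'n" assume M: "0 \<le> M" "\<And>k. t $ k \<le> M"
    have "\<psi> t \<le> C\<^sub>1 * top_coord t" unfolding \<psi>_def by (rule \<gamma>.recession_le)
    also have "top_coord t \<le> M" unfolding top_coord_def using M by (intro Max.boundedI) auto
    then have "C\<^sub>1 * top_coord t \<le> C\<^sub>1 * M" using C by (rule mult_left_mono)
    finally show "\<psi> t \<le> C\<^sub>1 * M" .
  qed (auto simp: \<psi>_def \<gamma>.recession_homogeneous \<gamma>.recession_subadditive C)
  have slope: "asymptotic_slope u x t = ereal (\<psi> t)" for t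
    unfolding asymptotic_slope_def
  proof (rule tendsto_Lim)
    show "((\<lambda>R. ereal (inverse R) * torus_max u x (R *\<^sub>R t)) \<longlongrightarrow> ereal (\<psi> t)) at_top"
      using tendsto_ereal[OF \<gamma>.recession_limit[of t]] by (simp add: \<gamma> \<psi>_def divide_inverse mult.commute)
  qed simp
  have ind: "\<psi>.extension \<in> indicators" by (rule \<psi>.extension_in_indicators)
  then have psh: "psh \<psi>.extension" by (simp add: indicators_def lelong_class_def)
  have off: "\<psi>.extension y = asymptotic_slope u x (\<chi> k. ln (cmod (y $ k)))" if "\<forall>k. y $ k \<noteq> 0" for y
    using \<psi>.extension_off_hyperplanes[of y] that by (simp add: slope log_coords_def)
  have eq: "indicator_at u x = \<psi>.extension"
    unfolding indicator_at_def
  proof (rule the_equality)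
    fix \<Psi> :: "complex ^ 'n \<Rightarrow> ereal"
    assume \<Psi>: "psh \<Psi> \<and> (\<forall>y. (\<forall>k. y $ k \<noteq> 0) \<longrightarrow> \<Psi> y = asymptotic_slope u x (\<chi> k. ln (cmod (y $ k))))"
    have "\<Psi> y \<le> \<psi>.extension y" for y
      by (rule psh_le_usc_off_hyperplanes[where x = 0]) (use \<Psi> off \<psi>.extension_usc in auto)
    moreover have "\<psi>.extension y \<le> \<Psi> y" for y
      by (rule psh_le_usc_off_hyperplanes[OF psh, where x = 0]) (use \<Psi> off in \<open>auto simp: psh_def\<close>)
    ultimately show "\<Psi> = \<psi>.extension" by (intro ext antisym)
  qed (use psh off in blast)
  have upper: "u z \<le> \<psi>.extension (z - x) + ereal (\<gamma> 0)" for z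
  proof (rule psh_le_usc_off_hyperplanes[OF u])
    have "upper_semicontinuous (\<lambda>z. \<psi>.extension (z - x))"
      by (rule usc_compose[OF \<psi>.extension_usc]) (intro continuous_intros)
    then have "upper_semicontinuous (\<lambda>z. \<psi>.extension (z - x) - ereal (- \<gamma> 0))"
      by (rule usc_diff_continuous) (use psh in \<open>auto simp: psh_def\<close>)
    then show "upper_semicontinuous (\<lambda>z. \<psi>.extension (z - x) + ereal (\<gamma> 0))"
      by (simp add: minus_ereal_def)
    fix z assume z: "\<And>k. z $ k \<noteq> x $ k"
    have "u z \<le> ereal (\<gamma> (log_coords x z))" using le_torus_max[of z x u] z by (simp add: \<gamma>)
    also have "\<dots> \<le> ereal (\<psi> (log_coords x z)) + ereal (\<gamma> 0)"
      using \<gamma>.le_recession[of "log_coords x z"] by (simp add: \<psi>_def)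
    also have "ereal (\<psi> (log_coords x z)) = \<psi>.extension (z - x)"
      using \<psi>.extension_off_hyperplanes[of "z - x"] z by (simp add: log_coords_shift)
    finally show "u z \<le> \<psi>.extension (z - x) + ereal (\<gamma> 0)" .
  qed
  have least: "\<psi>.extension y \<le> \<Phi> y"
    if \<Phi>: "\<Phi> \<in> indicators" and C': "\<And>z. u z \<le> \<Phi> (z - x) + ereal C'" for \<Phi> C' y
  proof (rule psh_le_usc_off_hyperplanes[OF psh, where x = 0])
    have psh\<Phi>: "psh \<Phi>" and circ: "circled \<Phi>"
      and hom: "\<And>c t. c > 0 \<Longrightarrow> convex_image \<Phi> (c *\<^sub>R t) = ereal c * convex_image \<Phi> t"
      using \<Phi> by (auto simp: indicators_def lelong_class_def)
    then show "upper_semicontinuous \<Phi>" by (simp add: psh_def)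
    have le: "ereal (\<gamma> t) \<le> convex_image \<Phi> t + ereal C'" for t
      unfolding \<gamma>[symmetric]
    proof (rule torus_max_le)
      fix z assume z: "\<And>k. z $ k \<noteq> x $ k" and t: "log_coords x z = t"
      have "\<Phi> (z - x) = convex_image \<Phi> t"
        using circled_eq_convex_image[OF circ, of "z - x"] z t by (simp add: log_coords_shift)
      then show "u z \<le> convex_image \<Phi> t + ereal C'" using C'[of z] by simp
    qed
    fix y :: "complex ^ 'n" assume y: "\<And>k. y $ k \<noteq> 0 $ k"
    define t where "t = log_coords 0 y"
    have "convex_image \<Phi> t \<noteq> \<infinity>" using psh\<Phi> by (simp add: psh_def convex_image_def)
    moreover have "convex_image \<Phi> t \<noteq> -\<infinity>" using le[of t] by auto
    ultimately obtain f where f: "convex_image \<Phi> t = ereal f" by (cases "convex_image \<Phi> t") auto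
    have "\<psi> t \<le> f"
      unfolding \<psi>_def
    proof (rule tendsto_le[OF _ _ \<gamma>.recession_limit])
      show "((\<lambda>R. f + C' / R) \<longlongrightarrow> f) at_top"
        using tendsto_add[OF tendsto_const tendsto_divide_0[OF tendsto_const filterlim_at_top_imp_at_infinity[OF filterlim_ident]], of f C'] by simp
      show "\<forall>\<^sub>F R in at_top. \<gamma> (R *\<^sub>R t) / R \<le> f + C' / R"
        using eventually_gt_at_top[of 0]
      proof eventually_elim
        case (elim R)
        have "\<gamma> (R *\<^sub>R t) \<le> R * f + C'" using le[of "R *\<^sub>R t"] hom[OF elim] f by simp
        then show ?case using elim by (simp add: field_simps)
      qed
    qed simp
    moreover have "\<Phi> y = ereal f" using circled_eq_convex_image[OF circ, of y] y f by (simp add: t_def)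
    moreover have "\<psi>.extension y = ereal (\<psi> t)" using \<psi>.extension_off_hyperplanes[of y] y by (simp add: t_def)
    ultimately show "\<psi>.extension y \<le> \<Phi> y" by simp
  qed
  show ?thesis
    unfolding eq
  proof (intro conjI exI[of _ "\<gamma> 0"] ballI impI allI)
    fix \<Phi> :: "complex ^ 'n \<Rightarrow> ereal" and y
    assume \<Phi>: "\<Phi> \<in> indicators" and "\<exists>C'::real. \<forall>z. u z \<le> \<Phi> (z - x) + ereal C'"
    then obtain C' :: real where "\<And>z. u z \<le> \<Phi> (z - x) + ereal C'" by blast
    then show "\<psi>.extension y \<le> \<Phi> y" by (rule least[OF \<Phi>])
  qed (use upper ind \<gamma> in auto)
qed

end
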